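(* For any $\beta\in(0,1)$ and $\tau\ge 0$ one has $$\mathsf{b}_\beta\,\mathbf{D}_\tau=\mathsf{b}_{\beta(\tau)},\qquad\text{where}\qquad \beta(\tau)=\frac{\beta e^{-\tau}}{1-\beta+\beta e^{-\tau}}.$$
   Context: A trajectory is an infinite lattice path in $\mathbb{Z}_{\ge 0}^2$ starting at $(0,0)$, each of whose steps is either up, $(a,b)\to(a,b+1)$, or right, $(a,b)\to(a+1,b)$. For $\beta\in(0,1)$, $\mathsf{b}_\beta$ is the distribution of the random trajectory whose steps are independent, each being up with probability $\beta$ and right with probability $1-\beta$. $\{\mathbf{D}_\tau\}_{\tau\ge 0}$ is the semigroup of the following continuous-time Markov process on the space of trajectories: each local piece (up, right) of the trajectory, i.e. $(m-1,n-1)\to(m-1,n)\to(m,n)$ with $m,n\in\mathbb{Z}_{\ge 1}$, is independently replaced by the piece (right, up), i.e. $(m-1,n-1)\to(m,n-1)\to(m,n)$, at rate $m+n-1$. The restrictions of this process to the triangles $\{m+n\le K\}$ are autonomous finite Markov chains which are compatible for different $K$, and so they define the process on the space of full trajectories. $\mathsf{b}_\beta\mathbf{D}_\tau$ is the distribution at time $\tau$ of the process started from $\mathsf{b}_\beta$. *)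

theory Defs
  imports "HOL-Probability.Probability"
begin

type_synonym point = "nat \<times> nat"

definition is_step :: "point \<Rightarrow> point \<Rightarrow> bool" where
  "is_step p q \<longleftrightarrow> q = (fst p, snd p + 1) \<or> q = (fst p + 1, snd p)"

definition trajectories :: "(nat \<Rightarrow> point) set" where
  "trajectories = {x. x 0 = (0, 0) \<and> (\<forall>k. is_step (x k) (x (Suc k)))}"

definition trajectory_space :: "(nat \<Rightarrow> point) measure" where
  "trajectory_space = restrict_space (PiM UNIV (\<lambda>_. count_space UNIV)) trajectories"

(* In a step sequence, True is an up step and False a right step. *)
primrec walk :: "(nat \<Rightarrow> bool) \<Rightarrow> nat \<Rightarrow> point" where
  "walk s 0 = (0, 0)"
| "walk s (Suc k) =
    (if s k then (fst (walk s k), snd (walk s k) + 1) else (fst (walk s k) + 1, snd (walk s k)))"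

definition bernoulli_trajectory :: "real \<Rightarrow> (nat \<Rightarrow> point) measure" where
  "bernoulli_trajectory \<beta> =
    distr (PiM UNIV (\<lambda>_. measure_pmf (bernoulli_pmf \<beta>))) trajectory_space walk"

(* A trajectory x satisfies fst (x k) + snd (x k) = k, so its part in the triangle
   of all (m, n) with m + n \<le> K is its restriction to the indices up to K. *)
definition triangle_paths :: "nat \<Rightarrow> (nat \<Rightarrow> point) set" where
  "triangle_paths K = (\<lambda>x. restrict x {..K}) ` trajectories"

definition has_corner :: "(nat \<Rightarrow> point) \<Rightarrow> nat \<Rightarrow> nat \<Rightarrow> bool" where
  "has_corner p m n \<longleftrightarrow>
    p (m + n - 2) = (m - 1, n - 1) \<and> p (m + n - 1) = (m - 1, n) \<and> p (m + n) = (m, n)"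

definition flip_corner :: "(nat \<Rightarrow> point) \<Rightarrow> nat \<Rightarrow> nat \<Rightarrow> nat \<Rightarrow> point" where
  "flip_corner p m n = p(m + n - 1 := (m, n - 1))"

definition jump_rate :: "nat \<Rightarrow> (nat \<Rightarrow> point) \<Rightarrow> (nat \<Rightarrow> point) \<Rightarrow> real" where
  "jump_rate K p q =
    (\<Sum>(m, n) \<in> {(m, n). 1 \<le> m \<and> 1 \<le> n \<and> m + n \<le> K \<and> has_corner p m n \<and> q = flip_corner p m n}.
       real (m + n - 1))"

definition generator :: "nat \<Rightarrow> (nat \<Rightarrow> point) \<Rightarrow> (nat \<Rightarrow> point) \<Rightarrow> real" where
  "generator K p q =
    (if p = q then - (\<Sum>r \<in> triangle_paths K - {p}. jump_rate K p r) else jump_rate K p q)"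

primrec generator_power :: "nat \<Rightarrow> nat \<Rightarrow> (nat \<Rightarrow> point) \<Rightarrow> (nat \<Rightarrow> point) \<Rightarrow> real" where
  "generator_power K 0 p q = (if p = q then 1 else 0)"
| "generator_power K (Suc i) p q =
    (\<Sum>r \<in> triangle_paths K. generator K p r * generator_power K i r q)"

(* The (p, q) entry of the matrix exponential of \<tau> times the generator. *)
definition triangle_transition :: "nat \<Rightarrow> real \<Rightarrow> (nat \<Rightarrow> point) \<Rightarrow> (nat \<Rightarrow> point) \<Rightarrow> real" where
  "triangle_transition K \<tau> p q = (\<Sum>i. \<tau> ^ i / fact i * generator_power K i p q)"

(* dynamics \<tau> x is the law at time \<tau> of the process on full trajectories started from x. The
   finite chain on a triangle performs exactly the replacements of pieces contained in
   that triangle. A piece crossing the boundary of the triangle of size K moves the last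
   vertex of the path in it, so the law of the first K steps under the chain on a larger
   triangle of size L depends on L; its value for the full process is the limit in L. *)
definition dynamics :: "real \<Rightarrow> (nat \<Rightarrow> point) \<Rightarrow> (nat \<Rightarrow> point) measure" where
  "dynamics \<tau> x = (THE M. prob_space M \<and> sets M = sets trajectory_space \<and>
    (\<forall>K. \<forall>w \<in> triangle_paths K.
      (\<lambda>L. \<Sum>v \<in> {v \<in> triangle_paths L. restrict v {..K} = w}.
         triangle_transition L \<tau> (restrict x {..L}) v)
      \<longlonglongrightarrow> measure M {y \<in> trajectories. restrict y {..K} = w}))"

end

theory Submission
  imports Defs
begin

text \<open>
  In terms of step sequences the process sorts neighbouring pairs (up, right), the pair at level
  \<open>j\<close> at rate \<open>j\<close>. For a product measure of density \<open>\<beta>\<close>, summation by parts shows that the generator acts by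
  the factor \<open>- (\<Sum>j. u j - \<beta>)\<close>, where \<open>u j\<close> is the indicator of an up step, up to a boundary term in the last
  step of the triangle. This factor is the logarithmic derivative of the product measure along the flow
  \<open>\<beta>' = - \<beta> (1 - \<beta>)\<close>, whose solution is \<open>\<beta>(\<tau>)\<close>.

  The boundary terms are harmless because information travels inward slowly: a discrepancy at
  level \<open>L\<close> reaches a fixed level within time \<open>\<tau>\<close> only with probability exponentially small in \<open>L\<close>
  (it moves like a time-reversed Yule process), whereas the total rate at the boundary is linear in \<open>L\<close>.
  The same estimate gives the convergence of the laws on growing triangles.
\<close>

section \<open>The semigroup on step sequences\<close>

text \<open>Why the rates are linear in the level: under a product measure of density
  \<open>\<beta>\<close>, bit \<open>j\<close> receives up steps from bit \<open>j - 1\<close> at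
  rate \<open>j * \<beta> * (1 - \<beta>)\<close> and passes them on at rate
  \<open>(j + 1) * \<beta> * (1 - \<beta>)\<close>. The density therefore drops at the same speed
  \<open>\<beta> * (1 - \<beta>)\<close> at every level. The obstacle is that total rates grow
  quadratically with the triangle, so there is no bounded generator on full trajectories, while on
  each finite triangle the identity fails at the last step. Everything is thus proved on triangles
  with errors that vanish as their size grows. The exponential of a generator is an alternating
  series, from which neither positivity nor the slow spread of discrepancies can be read. For these
  estimates it is replaced by powers of Euler steps \<open>1 + t / N * gen n\<close>, which are
  Markov kernels once \<open>N\<close> is large; the estimates are inductions over the steps with
  bounds that survive \<open>N\<close> tending to infinity. Time derivatives, in contrast, are taken
  on the series.\<close>

text \<open>The corner replacement at level \<open>i + 1\<close> exchanges steps \<open>i\<close> and \<open>i + 1\<close> if they are (up, right);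
  this is the same as sorting the two bits, which needs no case distinction.\<close>

definition sort_at :: "nat \<Rightarrow> (nat \<Rightarrow> bool) \<Rightarrow> nat \<Rightarrow> bool" where
  "sort_at i s = s(i := s i \<and> s (Suc i), Suc i := s i \<or> s (Suc i))"

text \<open>\<open>gen n\<close> is the generator on the triangle of size \<open>n + 1\<close>: its replacements exchange steps
  \<open>i\<close> and \<open>i + 1\<close> for \<open>i < n\<close>.\<close>

definition gen :: "nat \<Rightarrow> ((nat \<Rightarrow> bool) \<Rightarrow> real) \<Rightarrow> (nat \<Rightarrow> bool) \<Rightarrow> real" where
  "gen n f s = (\<Sum>i<n. real (Suc i) * (f (sort_at i s) - f s))"

text \<open>The exponential of \<open>t\<close> times \<open>gen n\<close>, acting on observables.
  For every \<open>n\<close> these are functions of infinite step sequences, so evolutions of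
  different triangles can be compared pointwise.\<close>

definition evol :: "nat \<Rightarrow> real \<Rightarrow> ((nat \<Rightarrow> bool) \<Rightarrow> real) \<Rightarrow> (nat \<Rightarrow> bool) \<Rightarrow> real" where
  "evol n t f s = (\<Sum>k. t ^ k / fact k * (gen n ^^ k) f s)"

definition euler :: "nat \<Rightarrow> real \<Rightarrow> ((nat \<Rightarrow> bool) \<Rightarrow> real) \<Rightarrow> (nat \<Rightarrow> bool) \<Rightarrow> real" where
  "euler n h f s = f s + h * gen n f s"

definition total_rate :: "nat \<Rightarrow> real" where
  "total_rate n = (\<Sum>i<n. real (Suc i))"

section \<open>Exponential series and Euler approximation\<close>

lemma total_rate_nonneg: "0 \<le> total_rate n"
  by (simp add: total_rate_def sum_nonneg)

lemma total_rate_Suc: "total_rate (Suc n) = total_rate n + real (Suc n)"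
  by (simp add: total_rate_def)

lemma gen_sum: "gen n (\<lambda>s. \<Sum>k\<in>S. c k * f k s) s = (\<Sum>k\<in>S. c k * gen n (f k) s)"
proof -
  have "gen n (\<lambda>s. \<Sum>k\<in>S. c k * f k s) s
      = (\<Sum>i<n. \<Sum>k\<in>S. real (Suc i) * (c k * (f k (sort_at i s) - f k s)))"
    by (simp add: gen_def sum_subtractf sum_distrib_left right_diff_distrib)
  also have "\<dots> = (\<Sum>k\<in>S. c k * gen n (f k) s)"
    by (subst sum.swap) (simp add: gen_def sum_distrib_left mult.left_commute)
  finally show ?thesis .
qed

text \<open>The operator norm is at most \<open>2 * total_rate n\<close>. This dominates the
  exponential series and, uniformly in the mesh, the expanded Euler powers.\<close>

lemma gen_bound:
  assumes "\<And>s. \<bar>f s\<bar> \<le> B"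
  shows "\<bar>gen n f s\<bar> \<le> 2 * total_rate n * B"
proof -
  have "\<bar>f (sort_at i s) - f s\<bar> \<le> 2 * B" for i
    using assms[of "sort_at i s"] assms[of s] by linarith
  then have "\<bar>real (Suc i) * (f (sort_at i s) - f s)\<bar> \<le> real (Suc i) * (2 * B)" for i
    by (simp add: abs_mult mult_left_mono)
  then have "\<bar>gen n f s\<bar> \<le> (\<Sum>i<n. real (Suc i) * (2 * B))"
    unfolding gen_def by (intro order_trans[OF sum_abs] sum_mono) 
  also have "\<dots> = 2 * total_rate n * B"
    by (simp add: total_rate_def sum_distrib_left sum_distrib_right mult.commute mult.left_commute)
  finally show ?thesis .
qed

lemma gen_power_bound:
  assumes "\<And>s. \<bar>f s\<bar> \<le> B"
  shows "\<bar>(gen n ^^ k) f s\<bar> \<le> (2 * total_rate n) ^ k * B"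
proof (induction k arbitrary: s)
  case (Suc k)
  then show ?case
    using gen_bound[of "(gen n ^^ k) f" "(2 * total_rate n) ^ k * B" n s] by (simp add: mult.assoc)
qed (simp add: assms)

lemma gen_power_sum:
  "(gen n ^^ m) (\<lambda>s. \<Sum>k\<in>S. c k * f k s) s = (\<Sum>k\<in>S. c k * (gen n ^^ m) (f k) s)"
proof (induction m arbitrary: s)
  case (Suc m)
  then have "(gen n ^^ m) (\<lambda>s. \<Sum>k\<in>S. c k * f k s) = (\<lambda>s. \<Sum>k\<in>S. c k * (gen n ^^ m) (f k) s)"
    by auto
  then show ?case by (simp add: gen_sum)
qed simp

lemma evol_series_summable:
  assumes "\<And>s. \<bar>f s\<bar> \<le> B"
  shows "summable (\<lambda>k. t ^ k / fact k * (gen n ^^ k) f s)"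
proof (rule summable_comparison_test')
  show "summable (\<lambda>k. inverse (fact k) * (2 * total_rate n * \<bar>t\<bar>) ^ k * B)"
    by (intro summable_mult2 summable_exp)
  fix k :: nat
  have "norm (t ^ k / fact k * (gen n ^^ k) f s) = \<bar>t\<bar> ^ k / fact k * \<bar>(gen n ^^ k) f s\<bar>"
    by (simp add: abs_mult power_abs)
  also have "\<dots> \<le> \<bar>t\<bar> ^ k / fact k * ((2 * total_rate n) ^ k * B)"
    by (intro mult_left_mono gen_power_bound assms) auto
  also have "\<dots> = inverse (fact k) * (2 * total_rate n * \<bar>t\<bar>) ^ k * B"
    by (simp add: power_mult_distrib field_simps)
  finally show "norm (t ^ k / fact k * (gen n ^^ k) f s) \<le> inverse (fact k) * (2 * total_rate n * \<bar>t\<bar>) ^ k * B" .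
qed

text \<open>The binomial theorem for the sum of the identity and \<open>h\<close> times
  \<open>gen n\<close>; the induction step is Pascal's rule.\<close>

lemma euler_power:
  "(euler n h ^^ N) f s = (\<Sum>k\<le>N. real (N choose k) * h ^ k * (gen n ^^ k) f s)"
proof (induction N arbitrary: s)
  case (Suc N)
  let ?g = "\<lambda>k. (gen n ^^ k) f s"
  have IH: "(euler n h ^^ N) f = (\<lambda>s. \<Sum>k\<le>N. (real (N choose k) * h ^ k) * (gen n ^^ k) f s)"
    using Suc by auto
  have "(euler n h ^^ Suc N) f s = (\<Sum>k\<le>N. real (N choose k) * h ^ k * ?g k)
      + h * (\<Sum>k\<le>N. (real (N choose k) * h ^ k) * ?g (Suc k))"
    by (simp add: IH euler_def[of _ _ "\<lambda>s. _ s"] gen_sum)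
  also have "(\<Sum>k\<le>N. real (N choose k) * h ^ k * ?g k)
      = (\<Sum>k\<le>Suc N. real (N choose k) * h ^ k * ?g k)"
    by simp
  also have "\<dots> = ?g 0 + (\<Sum>k\<le>N. real (N choose Suc k) * h ^ Suc k * ?g (Suc k))"
    by (subst sum.atMost_Suc_shift) simp
  finally show ?case
    by (subst sum.atMost_Suc_shift)
      (simp add: sum.distrib[symmetric] sum_distrib_left algebra_simps del: funpow.simps sum.atMost_Suc)
qed simp

lemma binomial_div_power_tendsto:
  "(\<lambda>N. real (N choose k) / real N ^ k) \<longlonglongrightarrow> 1 / fact k"
proof -
  have "(\<lambda>N. (\<Prod>i<k. (1 - real i / real N)) / fact k) \<longlonglongrightarrow> (\<Prod>i<k. (1 - 0)) / fact k"
    by (intro tendsto_intros lim_const_over_n) auto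
  moreover have "\<forall>\<^sub>F N in sequentially.
      (\<Prod>i<k. (1 - real i / real N)) / fact k = real (N choose k) / real N ^ k"
    using eventually_gt_at_top[of 0]
  proof eventually_elim
    case (elim N)
    have "(\<Prod>i<k. (1 - real i / real N)) = (\<Prod>i<k. (real N - real i) / real N)"
      using elim by (intro prod.cong) (auto simp: diff_divide_distrib)
    also have "\<dots> = (\<Prod>i<k. (real N - real i)) / real N ^ k"
      by (simp add: prod_dividef)
    finally have "(\<Prod>i<k. (1 - real i / real N)) = (\<Prod>i<k. (real N - real i)) / real N ^ k" .
    moreover have "real (N choose k) = (\<Prod>i<k. (real N - real i)) / fact k"
      by (simp add: binomial_gbinomial gbinomial_prod_rev lessThan_atLeast0)
    ultimately show ?case by simp
  qed
  ultimately show ?thesis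
    by (simp add: Lim_transform_eventually)
qed

text \<open>After binomial expansion the \<open>k\<close>-th term tends to the \<open>k\<close>-th
  term of the exponential series; domination by \<open>M\<close> allows the limit inside the
  sum.\<close>

lemma euler_tendsto_evol:
  assumes "\<And>s. \<bar>f s\<bar> \<le> B"
  shows "(\<lambda>N. (euler n (t / real N) ^^ N) f s) \<longlonglongrightarrow> evol n t f s"
proof -
  define a where "a k N = real (N choose k) * (t / real N) ^ k * (gen n ^^ k) f s" for k N
  define M where "M k = inverse (fact k) * (2 * total_rate n * \<bar>t\<bar>) ^ k * B" for k :: nat
  have eq: "suminf (\<lambda>k. a k N) = (euler n (t / real N) ^^ N) f s" for N
    unfolding euler_power a_def by (rule suminf_finite) auto
  have "(\<lambda>N. a k N) \<longlonglongrightarrow> t ^ k / fact k * (gen n ^^ k) f s" for k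
  proof -
    have "(\<lambda>N. (real (N choose k) / real N ^ k) * (t ^ k * (gen n ^^ k) f s))
        \<longlonglongrightarrow> 1 / fact k * (t ^ k * (gen n ^^ k) f s)"
      by (intro tendsto_intros binomial_div_power_tendsto)
    then show ?thesis by (simp add: a_def power_divide mult.assoc)
  qed
  moreover have "norm (a k N) \<le> M k" for k N
  proof -
    have 1: "real (N choose k) / real N ^ k \<le> inverse (fact k)"
    proof (cases "real N ^ k = 0")
      case False
      have "real (N choose k) * fact k \<le> real N ^ k"
        using binomial_fact_pow[of N k] by (metis of_nat_fact of_nat_le_iff of_nat_mult of_nat_power)
      moreover have "real N ^ k > 0" using False zero_le_power[of "real N" k] by simp
      ultimately show ?thesis by (simp add: field_simps)
    next
      \<comment> \<open>Here \<open>N = 0 < k\<close>, and division by zero yields 0.\<close>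
      case True
      show ?thesis unfolding True by simp
    qed
    have "norm (a k N) = (real (N choose k) / real N ^ k) * (\<bar>t\<bar> ^ k * \<bar>(gen n ^^ k) f s\<bar>)"
      by (simp add: a_def abs_mult power_abs power_divide)
    also have "\<dots> \<le> inverse (fact k) * (\<bar>t\<bar> ^ k * ((2 * total_rate n) ^ k * B))"
      using gen_power_bound[of f B k n s] assms 1 by (intro mult_mono mult_left_mono) auto
    also have "\<dots> = M k"
      by (simp add: M_def power_mult_distrib field_simps)
    finally show ?thesis .
  qed
  then have "\<forall>\<^sub>F (k, N) in at_top \<times>\<^sub>F sequentially. norm (a k N) \<le> M k"
    by (intro always_eventually) auto
  moreover have "summable M"
    unfolding M_def by (intro summable_mult2 summable_exp)
  ultimately have "(\<lambda>N. suminf (\<lambda>k. a k N)) \<longlonglongrightarrow> (\<Sum>k. t ^ k / fact k * (gen n ^^ k) f s)"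
    by (intro tannerys_theorem[THEN conjunct2, THEN conjunct2, of _ _ _ M] sequentially_bot)
  then show ?thesis by (simp add: eq evol_def)
qed

section \<open>Euler steps as Markov kernels\<close>

text \<open>The weights \<open>1 - h * total_rate n\<close> and \<open>h * (i + 1)\<close> sum to
  one, so for small \<open>h\<close> a step is an average of values of \<open>f\<close>.\<close>

lemma euler_eq:
  "euler n h f s = (1 - h * total_rate n) * f s + h * (\<Sum>i<n. real (Suc i) * f (sort_at i s))"
  by (simp add: euler_def gen_def total_rate_def right_diff_distrib sum_subtractf
      sum_distrib_left sum_distrib_right algebra_simps)

lemma euler_upper:
  assumes "0 \<le> h" "h * total_rate n \<le> 1" and "\<And>s. f s \<le> b"
  shows "euler n h f s \<le> b"
proof -
  have "euler n h f s \<le> (1 - h * total_rate n) * b + h * (\<Sum>i<n. real (Suc i) * b)"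
    unfolding euler_eq using assms by (intro add_mono mult_left_mono sum_mono) auto
  also have "\<dots> = b"
    by (simp add: total_rate_def algebra_simps sum_distrib_left sum_distrib_right)
  finally show ?thesis .
qed

lemma euler_lower:
  assumes "0 \<le> h" "h * total_rate n \<le> 1" and "\<And>s. b \<le> f s"
  shows "b \<le> euler n h f s"
proof -
  have "euler n h (\<lambda>s. - f s) s = - euler n h f s"
    by (simp add: euler_eq sum_negf)
  then show ?thesis
    using euler_upper[of h n "\<lambda>s. - f s" "- b" s] assms by simp
qed

lemma euler_power_range:
  assumes "0 \<le> h" "h * total_rate n \<le> 1" and "\<And>s. f s \<in> {a..b}"
  shows "(euler n h ^^ N) f s \<in> {a..b}"
  using assms(3)
proof (induction N arbitrary: s)
  case (Suc N)
  then show ?case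
    using euler_lower[OF assms(1,2), of a "(euler n h ^^ N) f" s]
      euler_upper[OF assms(1,2), of "(euler n h ^^ N) f" b s] by auto
qed simp

lemma eventually_euler_step_small:
  assumes "0 \<le> t"
  shows "\<forall>\<^sub>F N in sequentially. 0 < N \<and> t / real N * total_rate n \<le> 1 \<and> t / real N \<le> 1/2"
proof -
  \<comment> \<open>The three summands serve the bound by the total rate, the bound 1/2 and
    \<open>0 < N\<close>.\<close>
  obtain N0 :: nat where "t * total_rate n + 2 * t + 1 \<le> real N0"
    using real_arch_simple by blast
  moreover have "0 \<le> t * total_rate n" using assms total_rate_nonneg by simp
  ultimately have "0 < N \<and> t / real N * total_rate n \<le> 1 \<and> t / real N \<le> 1/2" if "N \<ge> N0" for N
    using that assms by (auto simp: field_simps)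
  then show ?thesis by (auto simp: eventually_sequentially)
qed

text \<open>Averages stay in the interval, and the interval is closed under limits. This yields
  positivity and normalisation of the evolution.\<close>

lemma evol_range:
  assumes "0 \<le> t" and f: "\<And>s. f s \<in> {a..b}"
  shows "evol n t f s \<in> {a..b}"
proof -
  have B: "\<bar>f s\<bar> \<le> \<bar>a\<bar> + \<bar>b\<bar>" for s
    using f[of s] by auto
  have "\<forall>\<^sub>F N in sequentially. (euler n (t / real N) ^^ N) f s \<in> {a..b}"
    using eventually_euler_step_small[OF assms(1), of n]
    by eventually_elim (use assms in \<open>intro euler_power_range; auto\<close>)
  then show ?thesis
    by (rule Lim_in_closed_set[OF closed_atLeastAtMost _ sequentially_bot euler_tendsto_evol[OF B]])
qed

text \<open>Two step sequences differing in one place keep differing in exactly one place when the same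
  pair of steps is sorted in both. This discrepancy moves left from \<open>j\<close> at rate at most \<open>j\<close>, which turns the
  profile \<open>r ^ j\<close> into at most \<open>(r + h * (1 - r)) ^ j\<close> in an Euler step of length \<open>h\<close>.\<close>

definition osc_bound :: "real \<Rightarrow> real \<Rightarrow> ((nat \<Rightarrow> bool) \<Rightarrow> real) \<Rightarrow> bool" where
  "osc_bound C r f \<longleftrightarrow> (\<forall>j s. \<bar>f (s(j := True)) - f (s(j := False))\<bar> \<le> C * r ^ j)"

lemma osc_boundD: "osc_bound C r f \<Longrightarrow> \<bar>f (s(j := True)) - f (s(j := False))\<bar> \<le> C * r ^ j"
  by (simp add: osc_bound_def)

lemma osc_bound_fun_upd:
  assumes "osc_bound C r f"
  shows "\<bar>f (s(j := a)) - f (s(j := b))\<bar> \<le> C * r ^ j"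
  using osc_boundD[OF assms, of s j]
  by (cases a; cases b) (auto simp: abs_minus_commute intro: order_trans[OF abs_ge_zero])

text \<open>Sorting amounts to two successive one-bit changes, at \<open>i\<close> and then at
  \<open>Suc i\<close>.\<close>

lemma osc_bound_sort_at:
  assumes "osc_bound C r f"
  shows "\<bar>f (sort_at i s) - f s\<bar> \<le> C * r ^ i + C * r ^ Suc i"
proof -
  let ?u = "s(i := s i \<and> s (Suc i))"
  have "\<bar>f ?u - f s\<bar> \<le> C * r ^ i"
    using osc_bound_fun_upd[OF assms, of s i "s i \<and> s (Suc i)" "s i"] by simp
  moreover have "\<bar>f (sort_at i s) - f ?u\<bar> \<le> C * r ^ Suc i"
    using osc_bound_fun_upd[OF assms, of ?u "Suc i" "s i \<or> s (Suc i)" "s (Suc i)"]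
    by (simp add: sort_at_def fun_upd_idem)
  ultimately show ?thesis by linarith
qed

text \<open>A differing bit at \<open>i\<close> stays or moves right, where the bound is smaller; at
  \<open>Suc i\<close> it stays or moves left to \<open>i\<close>. No second discrepancy arises, and
  only the left move raises the bound.\<close>

lemma sort_at_discrepancy:
  assumes f: "osc_bound C r f" and C: "0 \<le> C" and r: "0 < r" "r \<le> 1"
  shows "\<bar>f (sort_at i (s(j := True))) - f (sort_at i (s(j := False)))\<bar>
      \<le> C * r ^ (if j = Suc i then i else j)"
proof -
  have mono: "C * r ^ m \<le> C * r ^ k" if "k \<le> m" for k m
    using that r C by (intro mult_left_mono power_decreasing) auto
  consider "j = i" | "j = Suc i" | "j \<noteq> i" "j \<noteq> Suc i" by blast
  then show ?thesis
  proof cases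
    case 1
    show ?thesis
    proof (cases "s (Suc i)")
      case True
      then have "sort_at i (s(j := b)) = s(j := b)" for b
        using 1 by (auto simp: sort_at_def fun_eq_iff)
      then show ?thesis using osc_boundD[OF f, of s j] 1 by simp
    next
      case False
      then have "sort_at i (s(j := b)) = (s(i := False))(Suc i := b)" for b
        using 1 by (auto simp: sort_at_def fun_eq_iff)
      then show ?thesis
        using osc_boundD[OF f, of "s(i := False)" "Suc i"] 1 mono[of i "Suc i"] by simp
    qed
  next
    case 2
    show ?thesis
    proof (cases "s i")
      case True
      then have "sort_at i (s(j := b)) = (s(Suc i := True))(i := b)" for b
        using 2 by (auto simp: sort_at_def fun_eq_iff)
      then show ?thesis
        using osc_boundD[OF f, of "s(Suc i := True)" i] 2 by simp
    next
      case False
      then have "sort_at i (s(j := b)) = s(j := b)" for b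
        using 2 by (auto simp: sort_at_def fun_eq_iff)
      then show ?thesis using osc_boundD[OF f, of s j] 2 mono[of i j] by simp
    qed
  next
    case 3
    then have "sort_at i (s(j := b)) = (sort_at i s)(j := b)" for b
      by (auto simp: sort_at_def fun_eq_iff)
    then show ?thesis using osc_boundD[OF f, of "sort_at i s" j] 3 by simp
  qed
qed

text \<open>The left side consists of the first two terms of the binomial expansion.\<close>

lemma power_add_ge_linear:
  fixes r y :: real
  assumes "0 \<le> r" "0 \<le> y"
  shows "r ^ Suc j + real (Suc j) * r ^ j * y \<le> (r + y) ^ Suc j"
proof (induction j)
  case (Suc j)
  have "r ^ Suc (Suc j) + real (Suc (Suc j)) * r ^ Suc j * y
      \<le> (r + y) * (r ^ Suc j + real (Suc j) * r ^ j * y)"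
    using assms by (simp add: algebra_simps)
  also have "\<dots> \<le> (r + y) * (r + y) ^ Suc j"
    using assms Suc by (intro mult_left_mono) auto
  finally show ?case by simp
qed simp

text \<open>Only the sort at \<open>j - 1\<close> raises the bound, from \<open>r ^ j\<close> to
  \<open>r ^ (j - 1)\<close> and with weight \<open>h * j\<close>. The gain
  \<open>h * j * r ^ (j - 1) * (1 - r)\<close> is the linear term of
  \<open>(r + h * (1 - r)) ^ j\<close>.\<close>

lemma euler_osc_bound:
  assumes f: "osc_bound C r f" and C: "0 \<le> C" and r: "0 < r" "r \<le> 1"
    and h: "0 \<le> h" "h * total_rate n \<le> 1"
  shows "osc_bound C (r + h * (1 - r)) (euler n h f)"
  unfolding osc_bound_def
proof (intro allI)
  fix j and s :: "nat \<Rightarrow> bool"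
  let ?u = "s(j := True)" and ?v = "s(j := False)"
  let ?e = "\<lambda>i. if j = Suc i then i else j"
  have eq: "euler n h f ?u - euler n h f ?v = (1 - h * total_rate n) * (f ?u - f ?v)
      + h * (\<Sum>i<n. real (Suc i) * (f (sort_at i ?u) - f (sort_at i ?v)))"
    by (simp add: euler_eq right_diff_distrib sum_subtractf)
  have "\<bar>euler n h f ?u - euler n h f ?v\<bar> \<le> (1 - h * total_rate n) * \<bar>f ?u - f ?v\<bar>
      + h * (\<Sum>i<n. real (Suc i) * \<bar>f (sort_at i ?u) - f (sort_at i ?v)\<bar>)"
  proof -
    have "\<bar>\<Sum>i<n. real (Suc i) * (f (sort_at i ?u) - f (sort_at i ?v))\<bar>
        \<le> (\<Sum>i<n. real (Suc i) * \<bar>f (sort_at i ?u) - f (sort_at i ?v)\<bar>)"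
      by (rule order_trans[OF sum_abs]) (simp add: abs_mult)
    then show ?thesis
      unfolding eq using h by (intro order_trans[OF abs_triangle_ineq] add_mono) (auto simp: abs_mult intro!: mult_left_mono)
  qed
  also have "\<dots> \<le> (1 - h * total_rate n) * (C * r ^ j) + h * (\<Sum>i<n. real (Suc i) * (C * r ^ ?e i))"
  proof -
    have "(1 - h * total_rate n) * \<bar>f ?u - f ?v\<bar> \<le> (1 - h * total_rate n) * (C * r ^ j)"
      by (rule mult_left_mono[OF osc_boundD[OF f]]) (use h(2) in simp)
    moreover have "(\<Sum>i<n. real (Suc i) * \<bar>f (sort_at i ?u) - f (sort_at i ?v)\<bar>)
        \<le> (\<Sum>i<n. real (Suc i) * (C * r ^ ?e i))"
      by (intro sum_mono mult_left_mono sort_at_discrepancy[OF f C r] of_nat_0_le_iff)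
    ultimately show ?thesis
      using h(1) by (intro add_mono mult_left_mono[of _ _ h])
  qed
  \<comment> \<open>The weights sum to one, so only the excess over \<open>r ^ j\<close> remains
    under the sum.\<close>
  also have "\<dots> = C * r ^ j + h * (\<Sum>i<n. real (Suc i) * (C * (r ^ ?e i - r ^ j)))"
  proof -
    have "(\<Sum>i<n. real (Suc i) * (C * (r ^ ?e i - r ^ j)))
        = (\<Sum>i<n. real (Suc i) * (C * r ^ ?e i)) - total_rate n * (C * r ^ j)"
      by (simp only: total_rate_def right_diff_distrib sum_subtractf sum_distrib_right)
    then show ?thesis by (simp add: left_diff_distrib right_diff_distrib mult.assoc)
  qed
  also have "\<dots> \<le> C * (r + h * (1 - r)) ^ j"
  proof (cases j)
    case 0
    then show ?thesis by simp
  next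
    case (Suc i0)
    have nn: "0 \<le> r ^ i0 - r ^ j" using Suc r by (simp add: mult_left_le_one_le)
    have "(\<Sum>i<n. real (Suc i) * (C * (r ^ ?e i - r ^ j)))
        = (\<Sum>i<n. if i = i0 then real (Suc i) * (C * (r ^ i0 - r ^ j)) else 0)"
      using Suc by (intro sum.cong) auto
    \<comment> \<open>For \<open>i0 \<ge> n\<close> the sum is 0, hence only an inequality.\<close>
    also have "\<dots> \<le> real j * (C * (r ^ i0 - r ^ j))"
      using C nn Suc by (auto intro!: mult_nonneg_nonneg)
    also have "\<dots> = C * (real (Suc i0) * r ^ i0 * (1 - r))"
      using Suc by (simp add: algebra_simps)
    finally have "C * r ^ j + h * (\<Sum>i<n. real (Suc i) * (C * (r ^ ?e i - r ^ j)))
       \<le> C * r ^ j + h * (C * (real (Suc i0) * r ^ i0 * (1 - r)))"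
      using h by (intro add_left_mono mult_left_mono)
    also have "\<dots> = C * (r ^ Suc i0 + real (Suc i0) * r ^ i0 * (h * (1 - r)))"
      using Suc by (simp add: algebra_simps)
    also have "\<dots> \<le> C * (r + h * (1 - r)) ^ Suc i0"
      using r h C by (intro mult_left_mono power_add_ge_linear) auto
    finally show ?thesis using Suc by simp
  qed
  finally show "\<bar>euler n h f ?u - euler n h f ?v\<bar> \<le> C * (r + h * (1 - r)) ^ j" .
qed

lemma osc_bound_mono:
  assumes "osc_bound C r f" "0 \<le> C" "0 \<le> r" "r \<le> r'"
  shows "osc_bound C r' f"
  unfolding osc_bound_def
proof (intro allI)
  fix j and s :: "nat \<Rightarrow> bool"
  have "C * r ^ j \<le> C * r' ^ j"
    using assms by (intro mult_left_mono power_mono) auto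
  then show "\<bar>f (s(j := True)) - f (s(j := False))\<bar> \<le> C * r' ^ j"
    using osc_boundD[OF assms(1), of s j] by linarith
qed

text \<open>Each step multiplies \<open>1 - r\<close> by \<open>1 - h\<close>.\<close>

lemma euler_power_osc_bound:
  assumes f: "osc_bound C r f" and C: "0 \<le> C" and r: "0 < r" "r \<le> 1"
    and h: "0 \<le> h" "h * total_rate n \<le> 1" "h \<le> 1"
  shows "osc_bound C (1 - (1 - r) * (1 - h) ^ k) ((euler n h ^^ k) f)"
proof (induction k)
  case (Suc k)
  let ?r = "1 - (1 - r) * (1 - h) ^ k"
  have "(1 - r) * (1 - h) ^ k \<le> (1 - r) * 1"
    using r h by (intro mult_left_mono power_le_one) auto
  then have "0 < ?r" "?r \<le> 1" using r h by auto
  from euler_osc_bound[OF Suc C this h(1,2)] show ?case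
    by (simp add: algebra_simps)
qed (simp add: f)

text \<open>Starting from \<open>r = 1/2\<close>, the Euler steps up to time \<open>t\<close> lead to
  \<open>r = 1 - (1 - h) ^ k / 2\<close> with \<open>k h \<le> t\<close>; the factor 2 in the exponent leaves room for
  \<open>1 - h \<ge> exp (- 2 * h)\<close>.\<close>

definition spread :: "real \<Rightarrow> real" where
  "spread t = 1 - exp (- 2 * t) / 2"

lemma spread_bounds: "0 \<le> t \<Longrightarrow> 1/2 \<le> spread t" "spread t < 1"
  by (auto simp: spread_def)

lemma one_minus_ge_exp:
  fixes h :: real
  assumes "0 \<le> h" "h \<le> 1/2"
  shows "exp (- 2 * h) \<le> 1 - h"
proof -
  have "0 \<le> h * (1 - 2 * h)" using assms by (intro mult_nonneg_nonneg) auto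
  then have "1 \<le> (1 - h) * (1 + 2 * h)" by (simp add: algebra_simps)
  also have "\<dots> \<le> (1 - h) * exp (2 * h)"
    using assms by (intro mult_left_mono exp_ge_add_one_self) auto
  finally have "1 \<le> (1 - h) * exp (2 * h)" .
  then show ?thesis by (simp add: exp_minus field_simps)
qed

text \<open>The bound contains neither \<open>n\<close> nor \<open>N\<close> nor \<open>k\<close>,
  so it survives the passage to the exponential and the growth of the triangle.\<close>

lemma euler_power_osc_bound_spread:
  assumes f: "osc_bound C (1/2) f" and C: "0 \<le> C" and t: "0 \<le> t"
    and N: "0 < N" "t / real N * total_rate n \<le> 1" "t / real N \<le> 1/2" and k: "k \<le> N"
  shows "osc_bound C (spread t) ((euler n (t / real N) ^^ k) f)"
proof -
  let ?h = "t / real N"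
  have h: "0 \<le> ?h" "?h \<le> 1" using t N by auto
  have "exp (- 2 * t) = exp (- 2 * ?h) ^ N"
    using N by (simp add: exp_of_nat_mult[symmetric])
  also have "\<dots> \<le> (1 - ?h) ^ N"
    using h N by (intro power_mono one_minus_ge_exp) auto
  also have "\<dots> \<le> (1 - ?h) ^ k"
    using h k by (intro power_decreasing) auto
  finally have "1 - (1 - 1/2) * (1 - ?h) ^ k \<le> spread t"
    by (simp add: spread_def)
  moreover have "0 \<le> 1 - (1 - 1/2) * (1 - ?h) ^ k"
    using power_le_one[of "1 - ?h" k] h by auto
  ultimately show ?thesis
    using euler_power_osc_bound[OF f C _ _ h(1) N(2) h(2), of k] osc_bound_mono C by auto
qed

lemma evol_osc_bound:
  assumes f: "osc_bound C (1/2) f" and B: "\<And>s. \<bar>f s\<bar> \<le> B" and C: "0 \<le> C" and t: "0 \<le> t"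
  shows "osc_bound C (spread t) (evol n t f)"
  unfolding osc_bound_def
proof (intro allI)
  fix j and s :: "nat \<Rightarrow> bool"
  let ?u = "s(j := True)" and ?v = "s(j := False)"
  have "(\<lambda>N. \<bar>(euler n (t / real N) ^^ N) f ?u - (euler n (t / real N) ^^ N) f ?v\<bar>)
      \<longlonglongrightarrow> \<bar>evol n t f ?u - evol n t f ?v\<bar>"
    by (intro tendsto_intros euler_tendsto_evol[OF B])
  moreover have "\<forall>\<^sub>F N in sequentially.
      \<bar>(euler n (t / real N) ^^ N) f ?u - (euler n (t / real N) ^^ N) f ?v\<bar> \<le> C * spread t ^ j"
    using eventually_euler_step_small[OF t, of n]
    by eventually_elim (intro osc_boundD euler_power_osc_bound_spread f C t; simp)
  ultimately show "\<bar>evol n t f ?u - evol n t f ?v\<bar> \<le> C * spread t ^ j"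
    by (intro tendsto_upperbound) auto
qed

section \<open>Comparison of consecutive triangles\<close>

text \<open>A discrete Duhamel argument: the two Euler steps differ only by the sort at
  \<open>n\<close>, of rate \<open>n + 1\<close>, which changes the evolved observable by at most
  \<open>2 * C * spread t ^ n\<close>. Markov kernels do not amplify these errors, so they add up
  over the total time \<open>t\<close>.\<close>

lemma evol_Suc_diff:
  assumes f: "osc_bound C (1/2) f" and B: "\<And>s. \<bar>f s\<bar> \<le> B" and C: "0 \<le> C" and t: "0 \<le> t"
  shows "\<bar>evol (Suc n) t f s - evol n t f s\<bar> \<le> 2 * t * C * (real (Suc n) * spread t ^ n)"
proof -
  let ?D = "2 * C * (real (Suc n) * spread t ^ n)"
  have D: "\<bar>(euler (Suc n) (t / real N) ^^ k) f s - (euler n (t / real N) ^^ k) f s\<bar> \<le> real k * (t / real N * ?D)"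
    if N: "0 < N" "t / real N * total_rate (Suc n) \<le> 1" "t / real N \<le> 1/2" and "k \<le> N" for N k s
    using \<open>k \<le> N\<close>
  proof (induction k arbitrary: s)
    case (Suc k)
    let ?h = "t / real N"
    let ?g' = "(euler (Suc n) ?h ^^ k) f" and ?g = "(euler n ?h ^^ k) f"
    have h: "0 \<le> ?h" using t by simp
    have N': "?h * total_rate n \<le> 1"
    proof -
      have "?h * total_rate n \<le> ?h * total_rate (Suc n)"
        using h by (intro mult_left_mono) (auto simp: total_rate_Suc)
      then show ?thesis using N by linarith
    qed
    have g: "osc_bound C (spread t) ?g"
      using Suc N N' by (intro euler_power_osc_bound_spread f C t) auto
    have sp: "0 \<le> spread t" "spread t \<le> 1" using spread_bounds[of t] t by auto
    have "\<bar>?g (sort_at n s) - ?g s\<bar> \<le> C * spread t ^ n + C * spread t ^ Suc n"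
      by (rule osc_bound_sort_at[OF g])
    also have "\<dots> \<le> 2 * C * spread t ^ n"
    proof -
      have "C * (spread t * spread t ^ n) \<le> C * (1 * spread t ^ n)"
        using C sp by (intro mult_left_mono mult_right_mono) auto
      then show ?thesis by simp
    qed
    finally have diff: "\<bar>?g (sort_at n s) - ?g s\<bar> \<le> 2 * C * spread t ^ n" .
    have gs: "euler (Suc n) ?h ?g s - euler n ?h ?g s = ?h * (real (Suc n) * (?g (sort_at n s) - ?g s))"
      by (simp add: euler_def gen_def algebra_simps)
    have "\<bar>euler (Suc n) ?h ?g s - euler n ?h ?g s\<bar>
        = ?h * (real (Suc n) * \<bar>?g (sort_at n s) - ?g s\<bar>)"
      unfolding gs using h t by (simp add: abs_mult)
    also have "\<dots> \<le> ?h * (real (Suc n) * (2 * C * spread t ^ n))"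
      using h diff by (intro mult_left_mono) auto
    finally have 1: "\<bar>euler (Suc n) ?h ?g s - euler n ?h ?g s\<bar> \<le> ?h * ?D"
      by (simp add: mult_ac)
    \<comment> \<open>The old error is transported by the kernel of the larger triangle, which does
      not enlarge it.\<close>
    have lin: "euler (Suc n) ?h ?g' s - euler (Suc n) ?h ?g s = euler (Suc n) ?h (\<lambda>s. ?g' s - ?g s) s"
      by (simp add: euler_eq right_diff_distrib sum_subtractf)
    have "\<And>s. \<bar>?g' s - ?g s\<bar> \<le> real k * (?h * ?D)" using Suc by simp
    then have "\<bar>euler (Suc n) ?h (\<lambda>s. ?g' s - ?g s) s\<bar> \<le> real k * (?h * ?D)"
      using euler_upper[OF h N(2), of "\<lambda>s. ?g' s - ?g s" "real k * (?h * ?D)" s]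
        euler_lower[OF h N(2), of "- (real k * (?h * ?D))" "\<lambda>s. ?g' s - ?g s" s]
      by (simp add: abs_le_iff minus_le_iff)
    moreover have "real (Suc k) * (?h * ?D) = ?h * ?D + real k * (?h * ?D)"
      by (simp only: of_nat_Suc distrib_right mult_1)
    ultimately have "\<bar>euler (Suc n) ?h ?g' s - euler n ?h ?g s\<bar> \<le> real (Suc k) * (?h * ?D)"
      using 1 lin by linarith
    then show ?case by (simp only: funpow.simps o_apply)
  qed simp
  have "(\<lambda>N. \<bar>(euler (Suc n) (t / real N) ^^ N) f s - (euler n (t / real N) ^^ N) f s\<bar>)
      \<longlonglongrightarrow> \<bar>evol (Suc n) t f s - evol n t f s\<bar>"
    by (intro tendsto_intros euler_tendsto_evol[OF B])
  moreover have "\<forall>\<^sub>F N in sequentially.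
      \<bar>(euler (Suc n) (t / real N) ^^ N) f s - (euler n (t / real N) ^^ N) f s\<bar> \<le> t * ?D"
    using eventually_euler_step_small[OF t, of "Suc n"]
  proof eventually_elim
    case (elim N)
    then show ?case using D[of N N s] by simp
  qed
  ultimately have "\<bar>evol (Suc n) t f s - evol n t f s\<bar> \<le> t * ?D"
    by (intro tendsto_upperbound) auto
  then show ?thesis by (simp add: mult_ac)
qed

lemma summable_linear_geometric:
  fixes q :: real
  assumes "0 \<le> q" "q < 1"
  shows "summable (\<lambda>n. real (Suc n) * q ^ n)"
  using assms by (intro sums_summable[OF geometric_deriv_sums]) auto

text \<open>The increments in \<open>n\<close> are dominated by a summable sequence, so the
  telescoping series converges.\<close>

lemma evol_convergent:
  assumes f: "osc_bound C (1/2) f" and B: "\<And>s. \<bar>f s\<bar> \<le> B" and C: "0 \<le> C" and t: "0 \<le> t"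
  shows "convergent (\<lambda>n. evol n t f s)"
proof -
  have "summable (\<lambda>n. real (Suc n) * spread t ^ n)"
    using spread_bounds[of t] t by (intro summable_linear_geometric) auto
  then have "summable (\<lambda>n. 2 * t * C * (real (Suc n) * spread t ^ n))"
    by (rule summable_mult)
  then have "summable (\<lambda>n. evol (Suc n) t f s - evol n t f s)"
    by (rule summable_comparison_test'[where N=0]) (use evol_Suc_diff[OF assms] in auto)
  then have "convergent (\<lambda>n. \<Sum>k<n. evol (Suc k) t f s - evol k t f s)"
    by (simp add: summable_iff_convergent)
  then have "convergent (\<lambda>n. (evol n t f s - evol 0 t f s) + evol 0 t f s)"
    by (intro convergent_add convergent_const) (simp add: sum_lessThan_telescope[of "\<lambda>n. evol n t f s"])
  then show ?thesis by simp
qed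

section \<open>Bernoulli expectations along the logistic flow\<close>

definition depends_on :: "nat \<Rightarrow> ((nat \<Rightarrow> bool) \<Rightarrow> real) \<Rightarrow> bool" where
  "depends_on L f \<longleftrightarrow> (\<forall>s s'. (\<forall>i<L. s i = s' i) \<longrightarrow> f s = f s')"

lemma depends_onD: "depends_on L f \<Longrightarrow> (\<And>i. i < L \<Longrightarrow> s i = s' i) \<Longrightarrow> f s = f s'"
  by (simp add: depends_on_def)

lemma depends_on_mono: "depends_on K f \<Longrightarrow> K \<le> L \<Longrightarrow> depends_on L f"
  by (simp add: depends_on_def)

text \<open>The sorts at \<open>i < n\<close> touch the bits \<open>0, ..., n\<close>, hence
  \<open>Suc n\<close>.\<close>

lemma gen_depends_on:
  assumes "depends_on (Suc n) f"
  shows "depends_on (Suc n) (gen n f)"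
  unfolding depends_on_def gen_def
proof (intro allI impI sum.cong refl)
  fix s s' :: "nat \<Rightarrow> bool" and i
  assume *: "\<forall>i<Suc n. s i = s' i" "i \<in> {..<n}"
  then have "f s = f s'" "f (sort_at i s) = f (sort_at i s')"
    by (auto intro!: depends_onD[OF assms] simp: sort_at_def)
  then show "real (Suc i) * (f (sort_at i s) - f s) = real (Suc i) * (f (sort_at i s') - f s')"
    by simp
qed

lemma gen_power_depends_on: "depends_on (Suc n) f \<Longrightarrow> depends_on (Suc n) ((gen n ^^ k) f)"
  by (induction k) (auto intro: gen_depends_on)

lemma evol_depends_on: "depends_on (Suc n) f \<Longrightarrow> depends_on (Suc n) (evol n t f)"
  unfolding depends_on_def[of _ "evol n t f"] evol_def
  using depends_onD[OF gen_power_depends_on] by (intro allI impI) metis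

text \<open>The factor \<open>2 ^ K\<close> lifts the geometric profile to at least
  \<open>2 * B\<close> below \<open>K\<close>, and from \<open>K\<close> on the oscillation
  vanishes.\<close>

lemma osc_bound_depends_on:
  assumes f: "depends_on K f" and B: "\<And>s. \<bar>f s\<bar> \<le> B"
  shows "osc_bound (2 * B * 2 ^ K) (1/2) f"
  unfolding osc_bound_def
proof (intro allI)
  fix j and s :: "nat \<Rightarrow> bool"
  have B0: "0 \<le> B" using B[of s] by linarith
  show "\<bar>f (s(j := True)) - f (s(j := False))\<bar> \<le> 2 * B * 2 ^ K * (1/2) ^ j"
  proof (cases "j < K")
    case True
    have "(2::real) ^ K * (1/2) ^ j = 2 ^ (K - j)"
      using True by (simp add: power_diff power_one_over field_simps)
    also have "\<dots> \<ge> 1" by simp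
    finally have "2 * B * 1 \<le> 2 * B * (2 ^ K * (1/2) ^ j)"
      using B0 by (intro mult_left_mono) auto
    moreover have "\<bar>f (s(j := True)) - f (s(j := False))\<bar> \<le> 2 * B"
      using B[of "s(j := True)"] B[of "s(j := False)"] by linarith
    ultimately show ?thesis by (simp add: mult.assoc)
  next
    case False
    then have "f (s(j := True)) = f (s(j := False))"
      by (intro depends_onD[OF f]) auto
    then show ?thesis using B0 by simp
  qed
qed

section \<open>Bernoulli weights and the adjoint of the generator\<close>

text \<open>\<open>A\<close> is the set of up steps among the first \<open>L\<close>. Expectations
  become finite sums of polynomials in \<open>p\<close>, which can be differentiated along the
  flow.\<close>

definition weight :: "real \<Rightarrow> nat \<Rightarrow> nat set \<Rightarrow> real" where
  "weight p L A = p ^ card A * (1 - p) ^ (L - card A)"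

text \<open>Bits from \<open>L\<close> on are \<open>False\<close>; for \<open>f\<close> depending
  on \<open>L\<close> bits this is the Bernoulli expectation.\<close>

definition expect :: "real \<Rightarrow> nat \<Rightarrow> ((nat \<Rightarrow> bool) \<Rightarrow> real) \<Rightarrow> real" where
  "expect p L f = (\<Sum>A\<in>Pow {..<L}. weight p L A * f (\<lambda>i. i \<in> A))"

lemma card_subset_lessThan: "A \<subseteq> {..<L} \<Longrightarrow> finite A \<and> card A \<le> L"
  using finite_subset[of A "{..<L}"] card_mono[of "{..<L}" A] by auto

text \<open>Conditioning on the last bit. It serves to discard irrelevant bits and to extract the
  oscillation at the boundary bit.\<close>

lemma expect_Suc:
  "expect p (Suc n) f = expect p n (\<lambda>s. p * f (s(n := True)) + (1 - p) * f (s(n := False)))"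
proof -
  have P: "Pow {..<Suc n} = Pow {..<n} \<union> insert n ` Pow {..<n}"
    by (simp add: lessThan_Suc Pow_insert)
  have inj: "inj_on (insert n) (Pow {..<n})"
    by (auto simp: inj_on_def)
  have ins: "weight p (Suc n) (insert n A) * f (\<lambda>i. i \<in> insert n A)
      = weight p n A * (p * f ((\<lambda>i. i \<in> A)(n := True)))" if "A \<in> Pow {..<n}" for A
  proof -
    have "(\<lambda>i. i \<in> insert n A) = (\<lambda>i. i \<in> A)(n := True)" by (auto simp: fun_eq_iff)
    moreover have "card (insert n A) = Suc (card A)"
      using that card_subset_lessThan[of A n] by (intro card_insert_disjoint) auto
    then have "weight p (Suc n) (insert n A) = p * weight p n A"
      by (simp add: weight_def)
    ultimately show ?thesis by simp
  qed
  have noins: "weight p (Suc n) A * f (\<lambda>i. i \<in> A)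
      = weight p n A * ((1 - p) * f ((\<lambda>i. i \<in> A)(n := False)))" if "A \<in> Pow {..<n}" for A
  proof -
    have "(\<lambda>i. i \<in> A) = (\<lambda>i. i \<in> A)(n := False)" using that by (auto simp: fun_eq_iff)
    moreover have "weight p (Suc n) A = (1 - p) * weight p n A"
      using that card_subset_lessThan[of A n] by (simp add: weight_def Suc_diff_le)
    ultimately show ?thesis by simp
  qed
  have "expect p (Suc n) f = (\<Sum>A\<in>Pow {..<n}. weight p (Suc n) A * f (\<lambda>i. i \<in> A))
      + (\<Sum>A\<in>insert n ` Pow {..<n}. weight p (Suc n) A * f (\<lambda>i. i \<in> A))"
    unfolding expect_def P by (rule sum.union_disjoint) auto
  also have "(\<Sum>A\<in>insert n ` Pow {..<n}. weight p (Suc n) A * f (\<lambda>i. i \<in> A))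
      = (\<Sum>A\<in>Pow {..<n}. weight p n A * (p * f ((\<lambda>i. i \<in> A)(n := True))))"
    unfolding sum.reindex[OF inj] o_def by (rule sum.cong[OF refl ins])
  also have "(\<Sum>A\<in>Pow {..<n}. weight p (Suc n) A * f (\<lambda>i. i \<in> A))
      = (\<Sum>A\<in>Pow {..<n}. weight p n A * ((1 - p) * f ((\<lambda>i. i \<in> A)(n := False))))"
    by (rule sum.cong[OF refl noins])
  finally show ?thesis
    by (simp only: expect_def sum.distrib distrib_left add.commute)
qed

lemma expect_depends_on:
  assumes "depends_on K f" "K \<le> L"
  shows "expect p L f = expect p K f"
  using assms(2)
proof (induction L rule: dec_induct)
  case (step L)
  have "f (s(L := b)) = f s" for s b
    using step by (intro depends_onD[OF assms(1)]) auto
  then have "expect p (Suc L) f = expect p L f"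
    by (simp add: expect_Suc flip: distrib_right)
  then show ?case using step by simp
qed simp

lemma expect_const: "expect p L (\<lambda>_. c) = c"
proof -
  have "expect p L (\<lambda>_. c) = expect p 0 (\<lambda>_. c)"
    by (rule expect_depends_on) (auto simp: depends_on_def)
  then show ?thesis by (simp add: expect_def weight_def)
qed

lemma weight_nonneg: "0 \<le> p \<Longrightarrow> p \<le> 1 \<Longrightarrow> 0 \<le> weight p L A"
  by (simp add: weight_def)

lemma expect_mono:
  assumes "0 \<le> p" "p \<le> 1" "\<And>s. f s \<le> g s"
  shows "expect p L f \<le> expect p L g"
  unfolding expect_def using assms by (intro sum_mono mult_left_mono weight_nonneg) auto

lemma expect_abs_le:
  assumes p: "0 \<le> p" "p \<le> 1" and f: "\<And>s. \<bar>f s\<bar> \<le> D"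
  shows "\<bar>expect p L f\<bar> \<le> D"
proof -
  have "f s \<le> D" "- D \<le> f s" for s using f[of s] by auto
  then show ?thesis
    using expect_mono[OF p, of f "\<lambda>_. D" L] expect_mono[OF p, of "\<lambda>_. - D" f L]
    by (simp add: expect_const)
qed

text \<open>Exchanging \<open>i\<close> and \<open>Suc i\<close> maps the (up, right) sets
  bijectively onto the (right, up) sets and preserves the weight. The difference of the indicators
  of the two classes is the difference of the two bits.\<close>

lemma expect_sort_at:
  assumes "Suc i < L"
  shows "expect p L (\<lambda>s. f (sort_at i s) - f s)
      = expect p L (\<lambda>s. (of_bool (s (Suc i)) - of_bool (s i)) * f s)"
proof -
  let ?S = "{A \<in> Pow {..<L}. i \<in> A \<and> Suc i \<notin> A}"
  let ?T = "{A \<in> Pow {..<L}. i \<notin> A \<and> Suc i \<in> A}"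
  let ?w = "weight p L" and ?f = "\<lambda>A. f (\<lambda>i. i \<in> A)"
  let ?u = "\<lambda>A. insert (Suc i) (A - {i})" and ?d = "\<lambda>A. insert i (A - {Suc i})"
  have u: "?w (?u A) = ?w A" if "A \<in> ?S" for A
  proof -
    have "card (?u A) = Suc (card (A - {i}))" "Suc (card (A - {i})) = card A"
      using that card_subset_lessThan[of A L]
      by (auto intro!: card_insert_disjoint card_Suc_Diff1 simp del: card_Diff_insert)
    then show ?thesis by (simp add: weight_def)
  qed
  have sort: "sort_at i (\<lambda>i. i \<in> A) = (\<lambda>j. j \<in> ?u A)" if "A \<in> ?S" for A
    using that by (auto simp: sort_at_def fun_eq_iff)
  have triv: "sort_at i (\<lambda>i. i \<in> A) = (\<lambda>i. i \<in> A)" if "A \<notin> ?S" "A \<in> Pow {..<L}" for A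
    using that by (auto simp: sort_at_def fun_eq_iff)
  have "expect p L (\<lambda>s. f (sort_at i s) - f s)
      = (\<Sum>A\<in>?S. ?w A * (f (sort_at i (\<lambda>i. i \<in> A)) - ?f A))"
    unfolding expect_def using triv by (intro sum.mono_neutral_right) auto
  also have "\<dots> = (\<Sum>A\<in>?S. ?w (?u A) * ?f (?u A)) - (\<Sum>A\<in>?S. ?w A * ?f A)"
    using sort u by (simp add: right_diff_distrib sum_subtractf)
  also have "(\<Sum>A\<in>?S. ?w (?u A) * ?f (?u A)) = (\<Sum>A\<in>?T. ?w A * ?f A)"
    using assms by (intro sum.reindex_bij_witness[of _ ?d ?u]) (auto simp: insert_absorb)
  also have "(\<Sum>A\<in>?T. ?w A * ?f A) = (\<Sum>A\<in>Pow {..<L}. of_bool (i \<notin> A \<and> Suc i \<in> A) * (?w A * ?f A))"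
    by (intro sum.mono_neutral_cong_left) auto
  also have "(\<Sum>A\<in>?S. ?w A * ?f A) = (\<Sum>A\<in>Pow {..<L}. of_bool (i \<in> A \<and> Suc i \<notin> A) * (?w A * ?f A))"
    by (intro sum.mono_neutral_cong_left) auto
  finally show ?thesis
    unfolding expect_def sum_subtractf[symmetric] by (auto intro!: sum.cong simp: of_bool_def)
qed

text \<open>Summation by parts over the level: linear rates turn the differences of neighbouring
  bits into minus the number of up steps, plus \<open>n + 1\<close> times the last bit.\<close>

lemma expect_gen:
  "expect p (Suc n) (gen n f)
    = (\<Sum>A\<in>Pow {..<Suc n}. weight p (Suc n) A * (real (Suc n) * of_bool (n \<in> A) - real (card A)) * f (\<lambda>i. i \<in> A))"
proof -
  have parts: "(\<Sum>i<m. real (Suc i) * (u (Suc i) - u i)) = real (Suc m) * u m - (\<Sum>i<Suc m. u i)"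
    for u :: "nat \<Rightarrow> real" and m
    by (induction m) (auto simp: algebra_simps)
  have "expect p (Suc n) (gen n f) = (\<Sum>i<n. real (Suc i) * expect p (Suc n) (\<lambda>s. f (sort_at i s) - f s))"
    unfolding expect_def gen_def sum_distrib_left by (subst sum.swap) (simp only: mult.left_commute)
  also have "\<dots> = (\<Sum>i<n. real (Suc i) * expect p (Suc n) (\<lambda>s. (of_bool (s (Suc i)) - of_bool (s i)) * f s))"
    by (intro sum.cong refl) (simp add: expect_sort_at)
  also have "\<dots> = (\<Sum>A\<in>Pow {..<Suc n}. weight p (Suc n) A
      * (\<Sum>i<n. real (Suc i) * (of_bool (Suc i \<in> A) - of_bool (i \<in> A))) * f (\<lambda>i. i \<in> A))"
    unfolding expect_def sum_distrib_left sum_distrib_right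
    by (subst sum.swap) (simp only: mult_ac)
  also have "\<dots> = (\<Sum>A\<in>Pow {..<Suc n}. weight p (Suc n) A
      * (real (Suc n) * of_bool (n \<in> A) - real (card A)) * f (\<lambda>i. i \<in> A))"
  proof (intro sum.cong refl)
    fix A assume "A \<in> Pow {..<Suc n}"
    then have "(\<Sum>i<Suc n. of_bool (i \<in> A) :: real) = real (card A)"
      by (simp add: sum_of_bool_eq Int_absorb2 Int_absorb1 del: sum.lessThan_Suc)
    then show "weight p (Suc n) A * (\<Sum>i<n. real (Suc i) * (of_bool (Suc i \<in> A) - of_bool (i \<in> A))) * f (\<lambda>i. i \<in> A)
      = weight p (Suc n) A * (real (Suc n) * of_bool (n \<in> A) - real (card A)) * f (\<lambda>i. i \<in> A)"
      by (simp only: parts[where u="\<lambda>i. of_bool (i \<in> A)"])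
  qed
  finally show ?thesis .
qed

text \<open>With \<open>k\<close> up steps and \<open>m\<close> right steps, the logarithmic
  derivative along the flow is \<open>- k * (1 - b) + m * b = L * b - k\<close>.\<close>

lemma weight_deriv:
  assumes b: "(b has_real_derivative - (b t * (1 - b t))) (at t)" and A: "A \<subseteq> {..<L}"
  shows "((\<lambda>t. weight (b t) L A) has_real_derivative weight (b t) L A * (real L * b t - real (card A))) (at t)"
proof -
  define k m where "k = card A" and "m = L - card A"
  have L: "real L = real k + real m"
    using card_subset_lessThan[OF A] by (simp add: k_def m_def)
  \<comment> \<open>The split on \<open>k\<close> is due to the truncated exponent
    \<open>k - 1\<close> in the power rule.\<close>
  have "((\<lambda>t. b t ^ k) has_real_derivative - (real k * (1 - b t)) * b t ^ k) (at t)"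
    by (rule DERIV_cong[OF DERIV_power[OF b]]) (cases k; simp add: algebra_simps)
  moreover have "((\<lambda>t. (1 - b t) ^ m) has_real_derivative (real m * b t) * (1 - b t) ^ m) (at t)"
    by (rule DERIV_cong[OF DERIV_power[OF DERIV_diff[OF DERIV_const b]]]) (cases m; simp add: algebra_simps)
  ultimately have "((\<lambda>t. b t ^ k * (1 - b t) ^ m) has_real_derivative
      - (real k * (1 - b t)) * b t ^ k * (1 - b t) ^ m + (real m * b t) * (1 - b t) ^ m * b t ^ k) (at t)"
    by (rule DERIV_cong[OF DERIV_mult]) (simp add: algebra_simps)
  then show ?thesis
    unfolding weight_def L unfolding m_def[symmetric] unfolding k_def[symmetric]
    by (rule DERIV_cong) (simp add: algebra_simps)
qed

section \<open>Time derivatives and interpolation along the flow\<close>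

lemma gen_evol:
  assumes B: "\<And>s. \<bar>f s\<bar> \<le> B"
  shows "gen n (evol n t f) s = evol n t (gen n f) s"
proof -
  let ?c = "\<lambda>k s. t ^ k / fact k * (gen n ^^ k) f s"
  note sm = evol_series_summable[where t=t and n=n, OF B]
  have "gen n (evol n t f) s = (\<Sum>i<n. real (Suc i) * (\<Sum>k. ?c k (sort_at i s) - ?c k s))"
    unfolding gen_def[of n "evol n t f"] evol_def[of n t f]
    by (simp only: suminf_diff[OF sm sm])
  also have "\<dots> = (\<Sum>i<n. \<Sum>k. real (Suc i) * (?c k (sort_at i s) - ?c k s))"
    by (simp only: suminf_mult[OF summable_diff[OF sm sm]])
  also have "\<dots> = (\<Sum>k. \<Sum>i<n. real (Suc i) * (?c k (sort_at i s) - ?c k s))"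
    by (rule suminf_sum[symmetric]) (intro summable_mult summable_diff sm)
  also have "\<dots> = evol n t (gen n f) s"
    unfolding evol_def
  proof (rule suminf_cong)
    fix k
    have "(gen n ^^ k) (gen n f) = gen n ((gen n ^^ k) f)"
      by (simp add: funpow_swap1)
    then show "(\<Sum>i<n. real (Suc i) * (?c k (sort_at i s) - ?c k s)) = t ^ k / fact k * (gen n ^^ k) (gen n f) s"
      by (simp add: gen_def[of _ "(gen n ^^ k) f"] sum_distrib_left right_diff_distrib mult.left_commute del: of_nat_Suc)
  qed
  finally show ?thesis .
qed

text \<open>Kolmogorov's backward equation: for fixed \<open>s\<close> the evolution is an
  everywhere convergent power series in \<open>t\<close>, differentiated term by term.\<close>

lemma evol_deriv:
  assumes B: "\<And>s. \<bar>f s\<bar> \<le> B"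
  shows "((\<lambda>t. evol n t f s) has_real_derivative gen n (evol n t f) s) (at t)"
proof -
  let ?c = "\<lambda>k. (gen n ^^ k) f s / fact k"
  have eq: "evol n t f s = (\<Sum>k. ?c k * t ^ k)" for t
    by (simp add: evol_def mult.commute)
  have "summable (\<lambda>k. ?c k * y ^ k)" for y
    using evol_series_summable[where t=y and n=n and s=s, OF B] by (simp add: mult.commute)
  then have "((\<lambda>t. \<Sum>k. ?c k * t ^ k) has_real_derivative (\<Sum>k. diffs ?c k * t ^ k)) (at t)"
    by (rule termdiffs_strong_converges_everywhere)
  moreover have "(\<Sum>k. diffs ?c k * t ^ k) = evol n t (gen n f) s"
    unfolding evol_def
  proof (rule suminf_cong)
    fix k
    have "(gen n ^^ Suc k) f = (gen n ^^ k) (gen n f)"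
      by (simp add: funpow_swap1)
    then show "diffs ?c k * t ^ k = t ^ k / fact k * (gen n ^^ k) (gen n f) s"
      by (simp add: diffs_def field_simps del: funpow.simps of_nat_Suc)
  qed
  ultimately show ?thesis by (simp add: eq gen_evol[OF B])
qed

lemma evol_0: "evol n 0 f = f"
proof
  fix s
  have "evol n 0 f s = (\<Sum>k\<in>{0}. 0 ^ k / fact k * (gen n ^^ k) f s)"
    unfolding evol_def by (rule suminf_finite) auto
  then show "evol n 0 f s = f s" by simp
qed

text \<open>The derivative of \<open>s \<mapsto> expect (b s) (evol (\<tau> - s) f)\<close> would vanish for the full process; on the
  triangle only the term of the last step \<open>n\<close> survives, and it is controlled by the oscillation there.\<close>

lemma expect_evol_diff:
  assumes f: "osc_bound C (1/2) f" and B: "\<And>s. \<bar>f s\<bar> \<le> B" and C: "0 \<le> C" and \<tau>: "0 \<le> \<tau>"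
    and b: "\<And>t. (b has_real_derivative - (b t * (1 - b t))) (at t)" and b01: "\<And>t. 0 \<le> b t" "\<And>t. b t \<le> 1"
  shows "\<bar>expect (b \<tau>) (Suc n) f - expect (b 0) (Suc n) (evol n \<tau> f)\<bar> \<le> \<tau> * C * (real (Suc n) * spread \<tau> ^ n)"
proof (cases "\<tau> = 0")
  case False
  define F where "F s = expect (b s) (Suc n) (evol n (\<tau> - s) f)" for s
  define F' where "F' s = expect (b s) (Suc n) (\<lambda>x. - real (Suc n) * (of_bool (x n) - b s) * evol n (\<tau> - s) f x)" for s
  have deriv: "(F has_real_derivative F' s) (at s)" for s
  proof -
    let ?g = "evol n (\<tau> - s) f"
    have e: "((\<lambda>s. evol n (\<tau> - s) f x) has_real_derivative - gen n ?g x) (at s)" for x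
      using DERIV_chain2[OF evol_deriv[OF B] DERIV_diff[OF DERIV_const DERIV_ident]] by simp
    have "(F has_real_derivative (\<Sum>A\<in>Pow {..<Suc n}.
        weight (b s) (Suc n) A * (real (Suc n) * b s - real (card A)) * ?g (\<lambda>i. i \<in> A)
        + - gen n ?g (\<lambda>i. i \<in> A) * weight (b s) (Suc n) A)) (at s)"
      unfolding F_def expect_def by (intro DERIV_sum DERIV_mult e weight_deriv b) auto
    also have "(\<Sum>A\<in>Pow {..<Suc n}.
        weight (b s) (Suc n) A * (real (Suc n) * b s - real (card A)) * ?g (\<lambda>i. i \<in> A)
        + - gen n ?g (\<lambda>i. i \<in> A) * weight (b s) (Suc n) A)
      = (\<Sum>A\<in>Pow {..<Suc n}. weight (b s) (Suc n) A * (real (Suc n) * b s - real (card A)) * ?g (\<lambda>i. i \<in> A))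
        - expect (b s) (Suc n) (gen n ?g)"
      by (simp add: expect_def sum_subtractf mult.commute)
    \<comment> \<open>The terms \<open>card A\<close> from the flow and from the generator cancel;
      the factor \<open>(n + 1) * (b s - x n)\<close> is left.\<close>
    also have "\<dots> = F' s"
      unfolding expect_gen F'_def expect_def[of "b s" "Suc n" "\<lambda>x. _ x * _ x"] sum_subtractf[symmetric]
      by (intro sum.cong refl) (simp only: algebra_simps)
    finally show ?thesis .
  qed
  have bound: "\<bar>F' s\<bar> \<le> C * (real (Suc n) * spread \<tau> ^ n)" if "0 \<le> s" "s \<le> \<tau>" for s
  proof -
    let ?g = "evol n (\<tau> - s) f"
    have g0: "osc_bound C (spread (\<tau> - s)) ?g"
      using that by (intro evol_osc_bound[OF f B C]) auto
    have g1: "1/2 \<le> spread (\<tau> - s)"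
      using that by (intro spread_bounds) simp
    have g2: "spread (\<tau> - s) \<le> spread \<tau>"
      using that by (simp add: spread_def)
    have g: "osc_bound C (spread \<tau>) ?g"
      by (rule osc_bound_mono[OF g0 C _ g2]) (use g1 in linarith)
    \<comment> \<open>Averaging over bit \<open>n\<close> turns the centred factor into
      \<open>b s * (1 - b s)\<close> times the oscillation at \<open>n\<close>.\<close>
    have "F' s = expect (b s) n (\<lambda>x. - real (Suc n) * (b s * (1 - b s)) * (?g (x(n := True)) - ?g (x(n := False))))"
      unfolding F'_def expect_Suc by (simp add: algebra_simps)
    also have "\<bar>\<dots>\<bar> \<le> C * (real (Suc n) * spread \<tau> ^ n)"
    proof (rule expect_abs_le[OF b01])
      fix x
      have 1: "b s * (1 - b s) \<le> 1 * 1" using b01[of s] by (intro mult_mono) auto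
      have 2: "0 \<le> b s * (1 - b s)" using b01[of s] by simp
      have "\<bar>- real (Suc n) * (b s * (1 - b s)) * (?g (x(n := True)) - ?g (x(n := False)))\<bar>
          = real (Suc n) * ((b s * (1 - b s)) * \<bar>?g (x(n := True)) - ?g (x(n := False))\<bar>)"
        using b01[of s] by (simp add: abs_mult)
      also have "\<dots> \<le> real (Suc n) * (1 * (C * spread \<tau> ^ n))"
        using 1 2 osc_boundD[OF g, of x n] by (intro mult_left_mono mult_mono) auto
      finally show "\<bar>- real (Suc n) * (b s * (1 - b s)) * (?g (x(n := True)) - ?g (x(n := False)))\<bar>
          \<le> C * (real (Suc n) * spread \<tau> ^ n)"
        by (simp add: mult_ac)
    qed
    finally show ?thesis .
  qed
  obtain z where z: "0 < z" "z < \<tau>" "F \<tau> - F 0 = (\<tau> - 0) * F' z"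
    using MVT2[of 0 \<tau> F F'] deriv False \<tau> by auto
  have "\<bar>F \<tau> - F 0\<bar> \<le> \<tau> * (C * (real (Suc n) * spread \<tau> ^ n))"
    using z bound[of z] \<tau> by (simp add: abs_mult mult_left_mono)
  then show ?thesis by (simp add: F_def evol_0 mult.assoc)
next
  case True
  then show ?thesis by (simp add: evol_0)
qed

section \<open>Trajectories as walks of step sequences\<close>

definition initial_path :: "nat \<Rightarrow> (nat \<Rightarrow> bool) \<Rightarrow> nat \<Rightarrow> point" where
  "initial_path L s = restrict (walk s) {..L}"

definition steps :: "(nat \<Rightarrow> point) \<Rightarrow> nat \<Rightarrow> bool" where
  "steps x k \<longleftrightarrow> x (Suc k) = (fst (x k), snd (x k) + 1)"

lemma walk_coord_sum: "fst (walk s k) + snd (walk s k) = k"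
  by (induction k) auto

lemma walk_cong: "(\<And>i. i < k \<Longrightarrow> s i = s' i) \<Longrightarrow> walk s k = walk s' k"
  by (induction k) auto

lemma walk_in_trajectories: "walk s \<in> trajectories"
  by (auto simp: trajectories_def is_step_def)

lemma steps_walk: "steps (walk s) = s"
  by (auto simp: steps_def fun_eq_iff)

lemma walk_steps:
  assumes "x \<in> trajectories"
  shows "walk (steps x) = x"
proof
  fix k
  show "walk (steps x) k = x k"
  proof (induction k)
    case (Suc k)
    have "is_step (x k) (x (Suc k))" using assms by (simp add: trajectories_def)
    then show ?case using Suc by (auto simp: steps_def is_step_def)
  qed (use assms in \<open>simp add: trajectories_def\<close>)
qed

lemma trajectories_eq: "trajectories = range walk"
  using walk_in_trajectories walk_steps by (metis rangeI image_subsetI subsetI subset_antisym)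

lemma triangle_paths_range: "triangle_paths L = range (initial_path L)"
  by (simp add: triangle_paths_def trajectories_eq initial_path_def image_image)

text \<open>A path up to level \<open>L\<close> has \<open>L + 1\<close> vertices but
  \<open>L\<close> steps, and either family determines the other.\<close>

lemma initial_path_eq_iff: "initial_path L s = initial_path L s' \<longleftrightarrow> (\<forall>i<L. s i = s' i)"
proof
  assume *: "initial_path L s = initial_path L s'"
  have "walk s k = walk s' k" if "k \<le> L" for k
    using fun_cong[OF *, of k] that by (simp add: initial_path_def)
  then have "steps (walk s) i = steps (walk s') i" if "i < L" for i
    using that by (simp add: steps_def del: walk.simps)
  then show "\<forall>i<L. s i = s' i" by (simp add: steps_walk)
next
  assume "\<forall>i<L. s i = s' i"
  then show "initial_path L s = initial_path L s'"
    by (auto simp: initial_path_def intro!: restrict_ext walk_cong)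
qed

lemma restrict_initial_path: "K \<le> L \<Longrightarrow> restrict (initial_path L s) {..K} = initial_path K s"
  by (auto simp: initial_path_def fun_eq_iff)

lemma triangle_paths_eq: "triangle_paths L = (\<lambda>A. initial_path L (\<lambda>i. i \<in> A)) ` Pow {..<L}"
proof -
  have "initial_path L s \<in> (\<lambda>A. initial_path L (\<lambda>i. i \<in> A)) ` Pow {..<L}" for s
    by (rule image_eqI[where x="{i. i < L \<and> s i}"]) (auto simp: initial_path_eq_iff)
  then show ?thesis
    unfolding triangle_paths_range by blast
qed

lemma finite_triangle_paths: "finite (triangle_paths L)"
  by (simp add: triangle_paths_eq)

section \<open>Corner replacements as sorting of steps\<close>

lemma sort_at_trivial: "\<not> (s i \<and> \<not> s (Suc i)) \<Longrightarrow> sort_at i s = s"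
  by (auto simp: sort_at_def fun_eq_iff)

text \<open>Exchanging two steps leaves the positions before and after both of them unchanged; only
  the vertex in between moves.\<close>

lemma walk_sort_at:
  assumes "s i" "\<not> s (Suc i)"
  shows "walk (sort_at i s) = (walk s)(Suc i := (Suc (fst (walk s i)), snd (walk s i)))"
proof
  fix k
  let ?t = "sort_at i s"
  have low: "walk ?t k = walk s k" if "k \<le> i" for k
    using that by (intro walk_cong) (auto simp: sort_at_def)
  have mid: "walk ?t (Suc i) = (Suc (fst (walk s i)), snd (walk s i))"
    using assms low[of i] by (simp add: sort_at_def)
  have high: "walk ?t k = walk s k" if "Suc (Suc i) \<le> k" for k
    using that
  proof (induction k rule: dec_induct)
    case base
    show ?case
      using assms mid unfolding walk.simps(2)[of _ "Suc i"] by (simp add: sort_at_def)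
  next
    case (step k)
    then show ?case by (simp add: sort_at_def)
  qed
  consider "k \<le> i" | "k = Suc i" | "Suc (Suc i) \<le> k" by linarith
  then show "walk ?t k = ((walk s)(Suc i := (Suc (fst (walk s i)), snd (walk s i)))) k"
    by cases (auto simp: low mid high simp del: walk.simps)
qed

lemma has_corner_iff:
  assumes "1 \<le> m" "1 \<le> n" "m + n \<le> L"
  shows "has_corner (initial_path L s) m n \<longleftrightarrow>
    s (m + n - 2) \<and> \<not> s (Suc (m + n - 2)) \<and> walk s (m + n - 2) = (m - 1, n - 1)"
proof -
  define i where "i = m + n - 2"
  have i: "m + n = Suc (Suc i)" "m + n - 1 = Suc i" "i \<le> L" "Suc i \<le> L" "Suc (Suc i) \<le> L"
    using assms by (auto simp: i_def)
  show ?thesis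
    unfolding has_corner_def i_def[symmetric] i(1) i(2)
    using assms i(3-5) by (auto simp: initial_path_def i)
qed

lemma flip_corner_path:
  assumes "s i" "\<not> s (Suc i)" "Suc (Suc i) \<le> L" 
  shows "flip_corner (initial_path L s) (Suc (fst (walk s i))) (Suc (snd (walk s i))) = initial_path L (sort_at i s)"
proof -
  have "Suc (fst (walk s i)) + Suc (snd (walk s i)) - 1 = Suc i"
    using walk_coord_sum[of s i] by simp
  then show ?thesis
    using assms by (auto simp: flip_corner_def initial_path_def walk_sort_at fun_eq_iff simp del: walk.simps)
qed

text \<open>A path has one vertex per level, so a corner is determined by
  \<open>i = m + n - 2\<close>. Its rate \<open>m + n - 1\<close> is \<open>i + 1\<close>, and
  \<open>m + n \<le> L\<close> becomes \<open>Suc i < L\<close>.\<close>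

lemma jump_rate_path:
  "jump_rate L (initial_path L s) q =
    (\<Sum>i | Suc i < L \<and> s i \<and> \<not> s (Suc i) \<and> q = initial_path L (sort_at i s). real (Suc i))"
proof -
  let ?c = "\<lambda>i. (Suc (fst (walk s i)), Suc (snd (walk s i)))"
  let ?I = "{i. Suc i < L \<and> s i \<and> \<not> s (Suc i) \<and> q = initial_path L (sort_at i s)}"
  let ?C = "{(m, n). 1 \<le> m \<and> 1 \<le> n \<and> m + n \<le> L \<and> has_corner (initial_path L s) m n \<and> q = flip_corner (initial_path L s) m n}"
  have lev: "Suc (fst (walk s i)) + Suc (snd (walk s i)) = Suc (Suc i)" for i
    using walk_coord_sum[of s i] by simp
  have 1: "?c i \<in> ?C" if "i \<in> ?I" for i
  proof -
    have "Suc (fst (walk s i)) + Suc (snd (walk s i)) - 2 = i" "Suc (fst (walk s i)) + Suc (snd (walk s i)) \<le> L"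
      using that lev[of i] by auto
    then show ?thesis
      using that flip_corner_path[of s i L] by (subst mem_Collect_eq) (simp add: has_corner_iff del: walk.simps)
  qed
  have 2: "m + n - 2 \<in> ?I \<and> ?c (m + n - 2) = (m, n)" if "(m, n) \<in> ?C" for m n
  proof -
    have mn: "1 \<le> m" "1 \<le> n" "m + n \<le> L" "has_corner (initial_path L s) m n" "q = flip_corner (initial_path L s) m n"
      using that by auto
    then have c: "s (m + n - 2)" "\<not> s (Suc (m + n - 2))" "walk s (m + n - 2) = (m - 1, n - 1)"
      using has_corner_iff by blast+
    then have "?c (m + n - 2) = (m, n)" using mn by simp
    moreover have "q = initial_path L (sort_at (m + n - 2) s)"
      using flip_corner_path[of s "m + n - 2" L] c mn by simp
    ultimately show ?thesis using c mn by auto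
  qed
  have "(\<Sum>i\<in>?I. real (Suc i)) = (\<Sum>(m, n)\<in>?C. real (m + n - 1))"
  proof (rule sum.reindex_bij_witness[of _ "\<lambda>(m, n). m + n - 2" ?c])
    fix i assume "i \<in> ?I"
    show "(case ?c i of (m, n) \<Rightarrow> m + n - 2) = i" using lev[of i] by simp
    show "(case ?c i of (m, n) \<Rightarrow> real (m + n - 1)) = real (Suc i)" using lev[of i] by simp
    show "?c i \<in> ?C" by (rule 1) fact
  next
    fix b assume "b \<in> ?C"
    then show "?c (case b of (m, n) \<Rightarrow> m + n - 2) = b" "(case b of (m, n) \<Rightarrow> m + n - 2) \<in> ?I"
      using 2[of "fst b" "snd b"] by (auto simp only: prod.case_eq_if prod.collapse)
  qed
  then show ?thesis by (simp add: jump_rate_def)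
qed

text \<open>The diagonal entry makes the row sum vanish, so the matrix acts through differences of
  values, and sorts that change nothing contribute 0. \<open>L - 1\<close> is the number of
  \<open>i\<close> with \<open>Suc i < L\<close>.\<close>

lemma generator_path:
  "(\<Sum>r\<in>triangle_paths L. generator L (initial_path L s) r * \<phi> r) = gen (L - 1) (\<lambda>s. \<phi> (initial_path L s)) s"
proof -
  let ?T = "triangle_paths L" and ?p = "initial_path L s"
  let ?q = "\<lambda>i. initial_path L (sort_at i s)"
  let ?I = "{i. Suc i < L \<and> s i \<and> \<not> s (Suc i)}"
  have fin: "finite ?T" by (rule finite_triangle_paths)
  have finI: "finite ?I" by (rule finite_subset[of _ "{..<L}"]) auto
  have p: "?p \<in> ?T" by (simp add: triangle_paths_range)
  have J: "jump_rate L ?p r = (\<Sum>i\<in>?I. real (Suc i) * of_bool (r = ?q i))" for r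
    unfolding jump_rate_path using finI by (intro sum.mono_neutral_cong_left) auto
  have q: "?q i \<in> ?T - {?p}" if "i \<in> ?I" for i
    using that by (auto simp: triangle_paths_range initial_path_eq_iff sort_at_def)
  have "(\<Sum>r\<in>?T. generator L ?p r * \<phi> r)
      = generator L ?p ?p * \<phi> ?p + (\<Sum>r\<in>?T - {?p}. generator L ?p r * \<phi> r)"
    by (rule sum.remove[OF fin p])
  also have "(\<Sum>r\<in>?T - {?p}. generator L ?p r * \<phi> r) = (\<Sum>r\<in>?T - {?p}. jump_rate L ?p r * \<phi> r)"
    by (intro sum.cong) (auto simp: generator_def)
  also have "generator L ?p ?p * \<phi> ?p = - (\<Sum>r\<in>?T - {?p}. jump_rate L ?p r * \<phi> ?p)"
    by (simp add: generator_def sum_distrib_right)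
  also have "- (\<Sum>r\<in>?T - {?p}. jump_rate L ?p r * \<phi> ?p) + (\<Sum>r\<in>?T - {?p}. jump_rate L ?p r * \<phi> r)
      = (\<Sum>r\<in>?T - {?p}. jump_rate L ?p r * (\<phi> r - \<phi> ?p))"
    by (simp add: right_diff_distrib sum_subtractf)
  also have "\<dots> = (\<Sum>i\<in>?I. \<Sum>r\<in>?T - {?p}. of_bool (r = ?q i) * (real (Suc i) * (\<phi> r - \<phi> ?p)))"
    unfolding J sum_distrib_right by (subst sum.swap) (simp only: mult_ac)
  also have "\<dots> = (\<Sum>i\<in>?I. real (Suc i) * (\<phi> (?q i) - \<phi> ?p))"
  proof (rule sum.cong[OF refl])
    fix i assume i: "i \<in> ?I"
    have "(\<Sum>r\<in>?T - {?p}. of_bool (r = ?q i) * (real (Suc i) * (\<phi> r - \<phi> ?p)))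
        = (\<Sum>r\<in>?T - {?p}. if r = ?q i then real (Suc i) * (\<phi> (?q i) - \<phi> ?p) else 0)"
      by (intro sum.cong) auto
    then show "(\<Sum>r\<in>?T - {?p}. of_bool (r = ?q i) * (real (Suc i) * (\<phi> r - \<phi> ?p)))
        = real (Suc i) * (\<phi> (?q i) - \<phi> ?p)"
      using q[OF i] fin by (simp only: sum.delta finite_Diff if_True)
  qed
  also have "\<dots> = gen (L - 1) (\<lambda>s. \<phi> (initial_path L s)) s"
    unfolding gen_def
  proof (intro sum.mono_neutral_left ballI)
    fix i assume "i \<in> {..<L - 1} - ?I"
    then have "sort_at i s = s" by (intro sort_at_trivial) auto
    then show "real (Suc i) * (\<phi> (?q i) - \<phi> ?p) = 0" by simp
  qed auto
  finally show ?thesis .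
qed

lemma generator_power_path:
  "generator_power L k (initial_path L s) q = (gen (L - 1) ^^ k) (\<lambda>s. of_bool (initial_path L s = q)) s"
proof (induction k arbitrary: s)
  case (Suc k)
  have "generator_power L (Suc k) (initial_path L s) q
      = gen (L - 1) (\<lambda>s. generator_power L k (initial_path L s) q) s"
    by (simp add: generator_path)
  then show ?case by (simp add: Suc)
qed simp

lemma evol_sum:
  assumes "finite S" and "\<And>v s. v \<in> S \<Longrightarrow> \<bar>f v s\<bar> \<le> B"
  shows "evol n t (\<lambda>s. \<Sum>v\<in>S. f v s) s = (\<Sum>v\<in>S. evol n t (f v) s)"
proof -
  have "(\<Sum>v\<in>S. evol n t (f v) s) = (\<Sum>k. \<Sum>v\<in>S. t ^ k / fact k * (gen n ^^ k) (f v) s)"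
    unfolding evol_def by (rule suminf_sum[symmetric]) (rule evol_series_summable, rule assms)
  also have "\<dots> = evol n t (\<lambda>s. \<Sum>v\<in>S. f v s) s"
    using gen_power_sum[of _ _ "\<lambda>_. 1" f S] by (simp add: evol_def sum_distrib_left)
  finally show ?thesis by simp
qed

text \<open>By linearity, summing over the end paths that extend \<open>w\<close> evolves the
  indicator of \<open>w\<close>. The observable is now fixed and \<open>L\<close> enters through the
  generator alone.\<close>

lemma triangle_transition_marginal:
  assumes "K \<le> L"
  shows "(\<Sum>v \<in> {v \<in> triangle_paths L. restrict v {..K} = w}. triangle_transition L t (initial_path L s) v)
    = evol (L - 1) t (\<lambda>s. of_bool (initial_path K s = w)) s"
proof -
  let ?V = "{v \<in> triangle_paths L. restrict v {..K} = w}"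
  have fin: "finite ?V" by (simp add: finite_triangle_paths)
  have eq: "(\<Sum>v\<in>?V. of_bool (initial_path L s = v) :: real) = of_bool (initial_path K s = w)" for s
  proof -
    have "(\<Sum>v\<in>?V. of_bool (initial_path L s = v) :: real) = (\<Sum>v\<in>?V. if initial_path L s = v then 1 else 0)"
      by (simp add: of_bool_def)
    also have "\<dots> = of_bool (initial_path K s = w)"
      using fin assms by (subst sum.delta') (auto simp: restrict_initial_path triangle_paths_range)
    finally show ?thesis .
  qed
  have "(\<Sum>v\<in>?V. triangle_transition L t (initial_path L s) v) = (\<Sum>v\<in>?V. evol (L - 1) t (\<lambda>s. of_bool (initial_path L s = v)) s)"
    by (simp add: triangle_transition_def evol_def generator_power_path)
  also have "\<dots> = evol (L - 1) t (\<lambda>s. \<Sum>v\<in>?V. of_bool (initial_path L s = v)) s"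
    by (rule evol_sum[symmetric, where B=1]) (use fin in auto)
  finally show ?thesis by (simp only: eq)
qed

section \<open>Measures on trajectories\<close>

definition cylinder :: "nat \<Rightarrow> (nat \<Rightarrow> point) \<Rightarrow> (nat \<Rightarrow> point) set" where
  "cylinder K w = {y \<in> trajectories. restrict y {..K} = w}"

definition bit_space :: "(nat \<Rightarrow> bool) measure" where
  "bit_space = PiM UNIV (\<lambda>_. count_space UNIV)"

lemma space_bit_space [simp]: "space bit_space = UNIV"
  by (simp add: bit_space_def space_PiM)

lemma space_trajectory_space [simp]: "space trajectory_space = trajectories"
  by (simp add: trajectory_space_def space_restrict_space space_PiM)

lemma cylinder_subset: "cylinder K w \<subseteq> trajectories"
  by (auto simp: cylinder_def)

lemma mem_cylinder_walk: "walk s \<in> cylinder K w \<longleftrightarrow> initial_path K s = w"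
  by (simp add: cylinder_def walk_in_trajectories initial_path_def)

lemma mem_cylinder: "x \<in> cylinder K w \<longleftrightarrow> x \<in> trajectories \<and> initial_path K (steps x) = w"
  by (auto simp: cylinder_def initial_path_def walk_steps)

lemma coordinate_measurable [measurable]: "(\<lambda>x. x k) \<in> trajectory_space \<rightarrow>\<^sub>M count_space UNIV"
  unfolding trajectory_space_def by (intro measurable_restrict_space1 measurable_component_singleton) simp

lemma cylinder_sets: 
  assumes "w \<in> triangle_paths K"
  shows "cylinder K w \<in> sets trajectory_space"
proof -
  have "cylinder K w = {x \<in> space trajectory_space. \<forall>k\<in>{..K}. x k = w k}"
    using assms by (auto simp: cylinder_def triangle_paths_def fun_eq_iff)
  also have "\<dots> \<in> sets trajectory_space"
    by (intro sets.sets_Collect_finite_All measurable_sets_Collect[OF coordinate_measurable]) auto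
  finally show ?thesis .
qed

section \<open>The pi-system of cylinders\<close>

definition cylinders :: "(nat \<Rightarrow> point) set set" where
  "cylinders = insert {} {cylinder K w |K w. w \<in> triangle_paths K}"

lemma cylinders_subset: "cylinders \<subseteq> Pow trajectories"
  by (auto simp: cylinders_def cylinder_def)

text \<open>Two cylinders are nested or disjoint; the second case is the reason for including
  \<open>{}\<close>.\<close>

lemma Int_stable_cylinders: "Int_stable cylinders"
proof (rule Int_stableI)
  have *: "cylinder K w \<inter> cylinder L v \<in> cylinders" if "K \<le> L" "v \<in> triangle_paths L" for K L w v
  proof (cases "restrict v {..K} = w")
    case True
    then have "cylinder K w \<inter> cylinder L v = cylinder L v"
      using \<open>K \<le> L\<close> by (auto simp: mem_cylinder restrict_initial_path)
    then show ?thesis using that by (auto simp: cylinders_def)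
  next
    case False
    then have "cylinder K w \<inter> cylinder L v = {}"
      using \<open>K \<le> L\<close> by (auto simp: mem_cylinder restrict_initial_path)
    then show ?thesis by (simp add: cylinders_def)
  qed
  fix A B assume "A \<in> cylinders" "B \<in> cylinders"
  then consider "A = {} \<or> B = {}"
    | K w L v where "A = cylinder K w" "w \<in> triangle_paths K" "B = cylinder L v" "v \<in> triangle_paths L"
    by (auto simp: cylinders_def)
  then show "A \<inter> B \<in> cylinders"
  proof cases
    case 2
    then show ?thesis using *[of K L v w] *[of L K w v] by (cases "K \<le> L") (auto simp: Int_commute)
  qed (auto simp: cylinders_def)
qed

text \<open>For the harder inclusion: each event \<open>x k = p\<close> is a finite union of
  cylinders of size \<open>k\<close>, so coordinates are measurable for the generated
  sigma-algebra.\<close>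

lemma sets_trajectory_space: "sets trajectory_space = sigma_sets trajectories cylinders"
proof
  show "sigma_sets trajectories cylinders \<subseteq> sets trajectory_space"
  proof -
    have "cylinders \<subseteq> sets trajectory_space" by (auto simp: cylinders_def cylinder_sets)
    from sets.sigma_sets_subset[OF this] show ?thesis by simp
  qed
  let ?S = "sigma trajectories cylinders"
  have S: "space ?S = trajectories" "sets ?S = sigma_sets trajectories cylinders"
    using cylinders_subset by (auto simp: space_measure_of sets_measure_of)
  have "(\<lambda>x. x k) \<in> ?S \<rightarrow>\<^sub>M count_space UNIV" for k
  proof (subst measurable_count_space_eq_countable, simp, safe)
    fix p :: point
    have "(\<lambda>x. x k) -` {p} \<inter> space ?S = (\<Union>w\<in>{w\<in>triangle_paths k. w k = p}. cylinder k w)"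
      unfolding S by (auto simp: cylinder_def triangle_paths_def) (metis atMost_iff order_refl restrict_apply')
    also have "\<dots> \<in> sets ?S"
      unfolding S(2)
      by (rule sets.finite_UN[of _ _ ?S, unfolded S(2)])
        (auto simp: finite_triangle_paths cylinders_def)
    finally show "(\<lambda>x. x k) -` {p} \<inter> space ?S \<in> sets ?S" .
  qed auto
  then have id: "(\<lambda>x. x) \<in> ?S \<rightarrow>\<^sub>M trajectory_space"
    unfolding trajectory_space_def
    by (intro measurable_restrict_space2 measurable_PiM_single') (auto simp: S)
  show "sets trajectory_space \<subseteq> sigma_sets trajectories cylinders"
  proof
    fix A assume A: "A \<in> sets trajectory_space"
    then have "A \<subseteq> trajectories" using sets.sets_into_space by fastforce
    then show "A \<in> sigma_sets trajectories cylinders"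
      using measurable_sets[OF id A] S by (simp add: Int_absorb2)
  qed
qed

lemma measure_eq_cylinders:
  assumes M: "prob_space M" "sets M = sets trajectory_space"
    and N: "prob_space N" "sets N = sets trajectory_space"
    and eq: "\<And>K w. w \<in> triangle_paths K \<Longrightarrow> measure M (cylinder K w) = measure N (cylinder K w)"
  shows "M = N"
proof (rule measure_eqI_generator_eq[OF Int_stable_cylinders cylinders_subset, where A="\<lambda>_. trajectories"])
  interpret M: prob_space M by fact
  interpret N: prob_space N by fact
  show "emeasure M X = emeasure N X" if "X \<in> cylinders" for X
    using that eq by (auto simp: cylinders_def M.emeasure_eq_measure N.emeasure_eq_measure)
  show "emeasure M trajectories \<noteq> \<infinity>" by (simp add: M.emeasure_eq_measure)
  have "trajectories = cylinder 0 (initial_path 0 (\<lambda>_. False))"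
    by (auto simp: mem_cylinder initial_path_eq_iff)
  then have "trajectories \<in> cylinders" unfolding cylinders_def triangle_paths_range by blast
  then show "range (\<lambda>_. trajectories) \<subseteq> cylinders" by auto
qed (use M N sets_trajectory_space in auto)

lemma walk_measurable: "walk \<in> bit_space \<rightarrow>\<^sub>M trajectory_space"
proof -
  have "(\<lambda>s. walk s k) \<in> bit_space \<rightarrow>\<^sub>M count_space UNIV" for k
  proof (induction k)
    case (Suc k)
    have "(\<lambda>s. s k) \<in> bit_space \<rightarrow>\<^sub>M count_space UNIV"
      unfolding bit_space_def by (rule measurable_component_singleton) simp
    then have "{s \<in> space bit_space. s k} \<in> sets bit_space"
      by (rule predE)
    then show ?case
      unfolding walk.simps
      by (intro measurable_If measurable_compose[OF Suc]) auto
  qed simp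
  then show ?thesis
    unfolding trajectory_space_def
    by (intro measurable_restrict_space2 measurable_PiM_single') (auto simp: walk_in_trajectories)
qed

lemma depends_on_initial_path: "depends_on K (\<lambda>s. f (initial_path K s))"
  by (auto simp: depends_on_def initial_path_eq_iff intro!: arg_cong[of _ _ f])

text \<open>Only the cylinder of the first \<open>L\<close> steps of \<open>x\<close> contributes.
  Functions of finitely many steps are thus simple functions, which settles measurability and
  integrals.\<close>

lemma depends_on_expand:
  assumes "depends_on L f" "x \<in> trajectories"
  shows "f (steps x) = (\<Sum>A\<in>Pow {..<L}. f (\<lambda>i. i \<in> A) * indicator (cylinder L (initial_path L (\<lambda>i. i \<in> A))) x)"
proof -
  let ?A = "{i. i < L \<and> steps x i}"
  have "indicator (cylinder L (initial_path L (\<lambda>i. i \<in> A))) x = (if A = ?A then 1 else 0 :: real)"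
    if "A \<in> Pow {..<L}" for A
    using that assms(2) by (auto simp: indicator_def mem_cylinder initial_path_eq_iff)
  then have "(\<Sum>A\<in>Pow {..<L}. f (\<lambda>i. i \<in> A) * indicator (cylinder L (initial_path L (\<lambda>i. i \<in> A))) x)
      = (\<Sum>A\<in>Pow {..<L}. if A = ?A then f (\<lambda>i. i \<in> ?A) else 0)"
    by (intro sum.cong) auto
  also have "\<dots> = f (\<lambda>i. i \<in> ?A)"
    by (subst sum.delta) auto
  also have "\<dots> = f (steps x)"
    by (rule depends_onD[OF assms(1)]) auto
  finally show ?thesis by simp
qed

lemma steps_measurable:
  assumes "depends_on L f"
  shows "(\<lambda>x. f (steps x)) \<in> borel_measurable trajectory_space"
proof -
  have "(\<lambda>x. \<Sum>A\<in>Pow {..<L}. f (\<lambda>i. i \<in> A) * indicator (cylinder L (initial_path L (\<lambda>i. i \<in> A))) x)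
      \<in> borel_measurable trajectory_space"
    by (intro borel_measurable_sum borel_measurable_times borel_measurable_indicator cylinder_sets)
      (auto simp: triangle_paths_range)
  then show ?thesis
    by (rule measurable_cong[THEN iffD1, rotated]) (simp add: depends_on_expand[OF assms])
qed

lemma sets_PiM_bernoulli: "sets (PiM UNIV (\<lambda>_::nat. measure_pmf (bernoulli_pmf p))) = sets bit_space"
  unfolding bit_space_def by (rule sets_PiM_cong) auto

lemma sets_bernoulli_trajectory [simp, measurable_cong]: "sets (bernoulli_trajectory p) = sets trajectory_space"
  by (simp add: bernoulli_trajectory_def)

lemma space_bernoulli_trajectory [simp]: "space (bernoulli_trajectory p) = trajectories"
  by (simp add: bernoulli_trajectory_def)

lemma walk_measurable_bernoulli:
  "walk \<in> PiM UNIV (\<lambda>_. measure_pmf (bernoulli_pmf p)) \<rightarrow>\<^sub>M trajectory_space"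
  using walk_measurable by (simp cong: measurable_cong_sets add: sets_PiM_bernoulli)

lemma prob_space_bernoulli_trajectory: "prob_space (bernoulli_trajectory p)"
  unfolding bernoulli_trajectory_def
  by (intro prob_space.prob_space_distr prob_space_PiM walk_measurable_bernoulli) (rule prob_space_measure_pmf)

lemma bernoulli_trajectory_cylinder:
  assumes p: "0 \<le> p" "p \<le> 1" and A: "A \<subseteq> {..<L}"
  shows "measure (bernoulli_trajectory p) (cylinder L (initial_path L (\<lambda>i. i \<in> A))) = weight p L A"
proof -
  let ?M = "\<lambda>_::nat. measure_pmf (bernoulli_pmf p)"
  interpret product_prob_space ?M UNIV
    by unfold_locales 
  let ?w = "initial_path L (\<lambda>i. i \<in> A)"
  have w: "?w \<in> triangle_paths L" by (simp add: triangle_paths_range)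
  have "measure (bernoulli_trajectory p) (cylinder L ?w) = measure (PiM UNIV ?M) (walk -` cylinder L ?w \<inter> space (PiM UNIV ?M))"
    unfolding bernoulli_trajectory_def by (rule measure_distr[OF walk_measurable_bernoulli cylinder_sets[OF w]])
  also have "walk -` cylinder L ?w \<inter> space (PiM UNIV ?M) = prod_emb UNIV ?M {..<L} (PiE {..<L} (\<lambda>i. {i \<in> A}))"
    by (auto simp: mem_cylinder_walk initial_path_eq_iff prod_emb_def space_PiM PiE_def Pi_def)
  also have "measure (PiM UNIV ?M) \<dots> = (\<Prod>i<L. measure (?M i) {i \<in> A})"
    by (rule measure_PiM_emb) auto
  also have "\<dots> = (\<Prod>i<L. if i \<in> A then p else 1 - p)"
    using p by (intro prod.cong) (auto simp: measure_pmf_single)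
  also have "\<dots> = p ^ card ({..<L} \<inter> A) * (1 - p) ^ card ({..<L} \<inter> - A)"
    by (subst prod.If_cases) auto
  also have "{..<L} \<inter> A = A" using A by auto
  also have "card ({..<L} \<inter> - A) = L - card A"
    using A card_Diff_subset[of A "{..<L}"] finite_subset[OF A] by (simp add: Diff_eq)
  finally show ?thesis by (simp add: weight_def)
qed

lemma bernoulli_trajectory_integral:
  assumes p: "0 \<le> p" "p \<le> 1" and f: "depends_on L f"
  shows "(\<integral>x. f (steps x) \<partial>bernoulli_trajectory p) = expect p L f"
proof -
  interpret prob_space "bernoulli_trajectory p" by (rule prob_space_bernoulli_trajectory)
  let ?c = "\<lambda>A. cylinder L (initial_path L (\<lambda>i. i \<in> A))"
  have c: "?c A \<in> sets (bernoulli_trajectory p)" for A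
    by (simp add: cylinder_sets triangle_paths_range)
  have "(\<integral>x. f (steps x) \<partial>bernoulli_trajectory p)
      = (\<integral>x. (\<Sum>A\<in>Pow {..<L}. f (\<lambda>i. i \<in> A) * indicator (?c A) x) \<partial>bernoulli_trajectory p)"
    by (intro Bochner_Integration.integral_cong) (auto simp: depends_on_expand[OF f])
  also have "\<dots> = (\<Sum>A\<in>Pow {..<L}. f (\<lambda>i. i \<in> A) * measure (bernoulli_trajectory p) (?c A))"
    using c cylinder_subset by (subst Bochner_Integration.integral_sum) (auto simp: emeasure_eq_measure Int_absorb2)
  also have "\<dots> = expect p L f"
    unfolding expect_def by (intro sum.cong) (auto simp: bernoulli_trajectory_cylinder[OF p])
  finally show ?thesis .
qed

text \<open>The Kolmogorov extension theorem is available for Polish spaces, so bits are encoded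
  as the reals 0 and 1.\<close>

lemma ex_trajectory_measure:
  fixes Q :: "nat \<Rightarrow> nat set \<Rightarrow> real"
  assumes nonneg: "\<And>K A. A \<subseteq> {..<K} \<Longrightarrow> 0 \<le> Q K A"
    and init: "Q 0 {} = 1"
    and consistent: "\<And>K A. A \<subseteq> {..<K} \<Longrightarrow> Q K A = Q (Suc K) A + Q (Suc K) (insert K A)"
  shows "\<exists>M. prob_space M \<and> sets M = sets trajectory_space \<and>
    (\<forall>K A. A \<subseteq> {..<K} \<longrightarrow> measure M (cylinder K (initial_path K (\<lambda>i. i \<in> A))) = Q K A)"
proof -
  \<comment> \<open>Extended by 0, so that it is a mass function on all sets of naturals.\<close>
  define q where "q K A = (if A \<subseteq> {..<K} then Q K A else 0)" for K A
  have q_nonneg: "0 \<le> q K A" for K A by (simp add: q_def nonneg)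
  have total: "(\<Sum>A\<in>Pow {..<K}. Q K A) = 1" for K
  proof (induction K)
    case (Suc K)
    have "Pow {..<Suc K} = Pow {..<K} \<union> insert K ` Pow {..<K}"
      by (simp add: lessThan_Suc Pow_insert)
    then have "(\<Sum>A\<in>Pow {..<Suc K}. Q (Suc K) A)
        = (\<Sum>A\<in>Pow {..<K}. Q (Suc K) A) + (\<Sum>A\<in>insert K ` Pow {..<K}. Q (Suc K) A)"
      by (simp only:) (rule sum.union_disjoint; auto)
    also have "(\<Sum>A\<in>insert K ` Pow {..<K}. Q (Suc K) A) = (\<Sum>A\<in>Pow {..<K}. Q (Suc K) (insert K A))"
      by (subst sum.reindex) (auto simp: inj_on_def)
    also have "(\<Sum>A\<in>Pow {..<K}. Q (Suc K) A) + \<dots> = (\<Sum>A\<in>Pow {..<K}. Q K A)"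
      by (simp add: sum.distrib[symmetric] consistent)
    finally show ?case using Suc by simp
  qed (simp add: init)
  define \<mu> where "\<mu> K = embed_pmf (q K)" for K
  have "(\<integral>\<^sup>+A. ennreal (q K A) \<partial>count_space UNIV) = 1" for K
  proof -
    have "(\<integral>\<^sup>+A. ennreal (q K A) \<partial>count_space UNIV) = (\<Sum>A\<in>Pow {..<K}. ennreal (q K A))"
      by (rule nn_integral_count_space') (auto simp: q_def)
    also have "\<dots> = ennreal (\<Sum>A\<in>Pow {..<K}. Q K A)"
      by (subst sum_ennreal) (auto simp: q_def nonneg)
    finally show ?thesis by (simp add: total)
  qed
  then have pmf_\<mu>: "pmf (\<mu> K) A = q K A" for K A
    unfolding \<mu>_def by (rule pmf_embed_pmf[OF q_nonneg])
  have map_Suc: "map_pmf (\<lambda>A. A \<inter> {..<K}) (\<mu> (Suc K)) = \<mu> K" for K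
  proof (rule pmf_eqI)
    fix A
    show "pmf (map_pmf (\<lambda>A. A \<inter> {..<K}) (\<mu> (Suc K))) A = pmf (\<mu> K) A"
    proof (cases "A \<subseteq> {..<K}")
      case True
      have "pmf (map_pmf (\<lambda>A. A \<inter> {..<K}) (\<mu> (Suc K))) A
          = measure (\<mu> (Suc K)) ((\<lambda>A. A \<inter> {..<K}) -` {A})"
        by (rule pmf_map)
      \<comment> \<open>Any other set with trace \<open>A\<close> on \<open>{..<K}\<close> has an
        element above \<open>K\<close>, hence mass 0.\<close>
      also have "\<dots> = measure (\<mu> (Suc K)) {A, insert K A}"
        using True by (intro measure_prob_cong_0) (auto simp: pmf_\<mu> q_def lessThan_Suc)
      also have "\<dots> = Q (Suc K) A + Q (Suc K) (insert K A)"
      proof -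
        have "A \<noteq> insert K A" using True by auto
        then show ?thesis
          using True by (subst measure_measure_pmf_finite) (auto simp: pmf_\<mu> q_def lessThan_Suc)
      qed
      finally show ?thesis using True by (simp add: pmf_\<mu> q_def consistent)
    next
      case False
      then have "(\<lambda>A. A \<inter> {..<K}) -` {A} = {}" by auto
      then show ?thesis using False by (simp add: pmf_map pmf_\<mu> q_def)
    qed
  qed
  have map_le: "map_pmf (\<lambda>A. A \<inter> {..<K}) (\<mu> L) = \<mu> K" if "K \<le> L" for K L
    using that
  proof (induction L rule: dec_induct)
    case base
    have "map_pmf (\<lambda>A. A \<inter> {..<K}) (\<mu> K) = map_pmf (\<lambda>A. A) (\<mu> K)"
      by (intro map_pmf_cong) (auto simp: set_pmf_eq pmf_\<mu> q_def split: if_splits)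
    then show ?case by simp
  next
    case (step L)
    have "map_pmf (\<lambda>A. A \<inter> {..<K}) (\<mu> (Suc L)) = map_pmf (\<lambda>A. A \<inter> {..<K}) (map_pmf (\<lambda>A. A \<inter> {..<L}) (\<mu> (Suc L)))"
      using step by (auto simp: pmf.map_comp o_def intro!: map_pmf_cong)
    then show ?case using step by (simp add: map_Suc)
  qed
  define bits where "bits J A = (\<lambda>j\<in>J. if j \<in> A then 1 else 0 :: real)" for J :: "nat set" and A
  \<comment> \<open>The chosen size exceeds every element of \<open>J\<close>; inserting 0 covers
    empty \<open>J\<close>.\<close>
  define P where "P J = distr (\<mu> (Suc (Max (insert 0 J)))) (PiM J (\<lambda>_. borel)) (bits J)" for J
  have bits_meas: "bits J \<in> measure_pmf (\<mu> K) \<rightarrow>\<^sub>M PiM J (\<lambda>_. borel)" for J K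
    by (auto simp: bits_def space_PiM)
  have P_eq: "distr (\<mu> L) (PiM J (\<lambda>_. borel)) (bits J) = P J" if J: "finite J" "J \<subseteq> {..<L}" "0 < L" for J L
  proof -
    let ?K = "Suc (Max (insert 0 J))"
    have K: "?K \<le> L" "J \<subseteq> {..<?K}" using J by (auto simp: Suc_le_eq less_Suc_eq_le)
    have b: "bits J = bits J \<circ> (\<lambda>A. A \<inter> {..<?K})"
      using K by (auto simp: bits_def fun_eq_iff)
    have "distr (\<mu> L) (PiM J (\<lambda>_. borel)) (bits J)
        = distr (distr (\<mu> L) (count_space UNIV) (\<lambda>A. A \<inter> {..<?K})) (PiM J (\<lambda>_. borel)) (bits J)"
      by (subst distr_distr) (auto simp: b[symmetric] bits_def space_PiM)
    then show ?thesis
      by (simp only: P_def map_le[OF K(1), symmetric] map_pmf_rep_eq)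
  qed
  have prob_P: "prob_space (P J)" for J
    unfolding P_def by (intro prob_space.prob_space_distr bits_meas prob_space_measure_pmf)
  interpret P: polish_projective UNIV P
  proof (intro polish_projective.intro projective_family.intro)
    fix J H :: "nat set" assume *: "J \<subseteq> H" "finite H"
    let ?L = "Suc (Max (insert 0 H))"
    have fin: "finite J" using * finite_subset by blast
    have sub: "J \<subseteq> {..<?L}" using * by (auto simp: less_Suc_eq_le)
    have comp: "(\<lambda>f. restrict f J) \<circ> bits H = bits J"
      using * by (auto simp: bits_def fun_eq_iff)
    have "distr (P H) (PiM J (\<lambda>_. borel)) (\<lambda>f. restrict f J)
        = distr (\<mu> ?L) (PiM J (\<lambda>_. borel)) ((\<lambda>f. restrict f J) \<circ> bits H)"
      unfolding P_def by (intro distr_distr measurable_restrict_subset bits_meas *)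
    also have "\<dots> = P J" unfolding comp by (rule P_eq[OF fin sub]) simp
    finally show "P J = distr (P H) (PiM J (\<lambda>_. borel)) (\<lambda>f. restrict f J)" by simp
  qed (rule prob_P)
  \<comment> \<open>The threshold 1/2 decodes reals into bits on the whole space, also at values
    other than 0 and 1.\<close>
  let ?g = "\<lambda>\<omega>::nat \<Rightarrow> real. walk (\<lambda>i. 1/2 < \<omega> i)"
  have "(\<lambda>\<omega>::nat \<Rightarrow> real. \<lambda>i. 1/2 < \<omega> i) \<in> PiM UNIV (\<lambda>_. borel) \<rightarrow>\<^sub>M bit_space"
    unfolding bit_space_def by (intro measurable_PiM_single') auto
  then have "?g \<in> PiM UNIV (\<lambda>_. borel) \<rightarrow>\<^sub>M trajectory_space"
    by (rule measurable_compose[OF _ walk_measurable])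
  then have g: "?g \<in> P.lim \<rightarrow>\<^sub>M trajectory_space"
    by (simp cong: measurable_cong_sets)
  define M where "M = distr P.lim trajectory_space ?g"
  have "measure M (cylinder K (initial_path K (\<lambda>i. i \<in> A))) = Q K A" if A: "A \<subseteq> {..<K}" for K A
  proof (cases "K = 0")
    \<comment> \<open>\<open>P_eq\<close> requires positive size; for size 0 the cylinder is the
      whole space.\<close>
    case True
    then have "cylinder K (initial_path K (\<lambda>i. i \<in> A)) = space M"
      by (auto simp: M_def mem_cylinder initial_path_eq_iff)
    moreover have "prob_space M"
      unfolding M_def by (rule P.P.prob_space_distr[OF g])
    ultimately show ?thesis using True A init prob_space.prob_space by auto
  next
    case False
    let ?C = "cylinder K (initial_path K (\<lambda>i. i \<in> A))"
    define X where "X = {f \<in> space (PiM {..<K} (\<lambda>_. borel :: real measure)). \<forall>i\<in>{..<K}. (1/2 < f i) = (i \<in> A)}"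
    have X: "X \<in> sets (PiM {..<K} (\<lambda>_. borel))"
      unfolding X_def by measurable
    have "measure M ?C = measure P.lim (?g -` ?C \<inter> space P.lim)"
      unfolding M_def by (intro measure_distr g cylinder_sets) (simp add: triangle_paths_range)
    also have "?g -` ?C \<inter> space P.lim = P.emb UNIV {..<K} X"
      by (auto simp: X_def mem_cylinder_walk initial_path_eq_iff prod_emb_def space_PiM)
    also have "measure P.lim \<dots> = measure (P {..<K}) X"
      by (rule P.measure_lim_emb) (use X in auto)
    also have "P {..<K} = distr (\<mu> K) (PiM {..<K} (\<lambda>_. borel)) (bits {..<K})"
      using False by (intro P_eq[symmetric]) auto
    also have "measure \<dots> X = measure (\<mu> K) (bits {..<K} -` X \<inter> space (\<mu> K))"
      by (rule measure_distr[OF bits_meas X])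
    also have "\<dots> = measure (\<mu> K) {A}"
    proof (rule measure_prob_cong_0)
      fix B assume "B \<in> bits {..<K} -` X \<inter> space (\<mu> K) - {A}"
      then have B: "\<forall>i<K. i \<in> B \<longleftrightarrow> i \<in> A" "B \<noteq> A"
        by (auto simp: X_def bits_def split: if_splits)
      then have "\<not> B \<subseteq> {..<K}" using A by blast
      then show "pmf (\<mu> K) B = 0" by (simp add: pmf_\<mu> q_def)
    next
      fix B assume "B \<in> {A} - bits {..<K} -` X \<inter> space (\<mu> K)"
      then show "pmf (\<mu> K) B = 0" by (auto simp: X_def bits_def space_PiM)
    qed
    also have "\<dots> = Q K A" using A by (simp add: measure_pmf_single pmf_\<mu> q_def)
    finally show ?thesis .
  qed
  moreover have "prob_space M"
    unfolding M_def by (rule P.P.prob_space_distr[OF g])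
  moreover have "sets M = sets trajectory_space" by (simp add: M_def)
  ultimately show ?thesis by blast
qed

section \<open>The law of the full process\<close>

lemma evol_path_convergent:
  assumes "0 \<le> t"
  shows "convergent (\<lambda>n. evol n t (\<lambda>s. of_bool (initial_path K s = w)) s)"
proof -
  let ?f = "\<lambda>s. of_bool (initial_path K s = w) :: real"
  have "osc_bound (2 * 1 * 2 ^ K) (1/2) ?f"
    by (intro osc_bound_depends_on depends_on_initial_path) auto
  then show ?thesis
    by (rule evol_convergent[where B=1]) (use assms in auto)
qed

text \<open>Gives meaning to the definite description in \<open>dynamics\<close>. Nonnegativity,
  normalisation and consistency of the cylinder weights pass to the limit, so these extend to a
  measure, which its values on cylinders determine.\<close>

lemma dynamics_exists_unique:
  assumes t: "0 \<le> t" and x: "x \<in> trajectories"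
  shows "\<exists>!M. prob_space M \<and> sets M = sets trajectory_space \<and>
    (\<forall>K. \<forall>w \<in> triangle_paths K.
      (\<lambda>L. \<Sum>v \<in> {v \<in> triangle_paths L. restrict v {..K} = w}.
         triangle_transition L t (restrict x {..L}) v)
      \<longlonglongrightarrow> measure M {y \<in> trajectories. restrict y {..K} = w})" (is "\<exists>!M. ?P M")
proof -
  define s where "s = steps x"
  let ?f = "\<lambda>K w s. of_bool (initial_path K s = w) :: real"
  define Q where "Q K A = lim (\<lambda>n. evol n t (?f K (initial_path K (\<lambda>i. i \<in> A))) s)" for K A
  have Q: "(\<lambda>n. evol n t (?f K (initial_path K (\<lambda>i. i \<in> A))) s) \<longlonglongrightarrow> Q K A" for K A
    unfolding Q_def using evol_path_convergent[OF t] by (simp add: convergent_LIMSEQ_iff)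
  have nonneg: "0 \<le> Q K A" for K A
  proof (rule LIMSEQ_le_const[OF Q])
    have "0 \<le> evol n t (?f K (initial_path K (\<lambda>i. i \<in> A))) s" for n
      using evol_range[OF t, of "?f K (initial_path K (\<lambda>i. i \<in> A))" 0 1 n s] by auto
    then show "\<exists>N. \<forall>n\<ge>N. 0 \<le> evol n t (?f K (initial_path K (\<lambda>i. i \<in> A))) s" by blast
  qed
  have init: "Q 0 {} = 1"
  proof (rule LIMSEQ_unique[OF Q])
    have "evol n t (?f 0 (initial_path 0 (\<lambda>i. i \<in> {}))) s = 1" for n
      using evol_range[OF t, of "?f 0 (initial_path 0 (\<lambda>i. i \<in> {}))" 1 1 n s]
      by (auto simp: initial_path_eq_iff)
    then show "(\<lambda>n. evol n t (?f 0 (initial_path 0 (\<lambda>i. i \<in> {}))) s) \<longlonglongrightarrow> 1" by simp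
  qed
  have consistent: "Q K A = Q (Suc K) A + Q (Suc K) (insert K A)" if A: "A \<subseteq> {..<K}" for K A
  proof (rule LIMSEQ_unique[OF Q])
    let ?g = "\<lambda>B. ?f (Suc K) (initial_path (Suc K) (\<lambda>i. i \<in> B))"
    have neq: "A \<noteq> insert K A" using A by auto
    have pair: "(\<Sum>B\<in>{A, insert K A}. h B) = h A + h (insert K A)" for h :: "nat set \<Rightarrow> real"
      using neq by simp
    have "?f K (initial_path K (\<lambda>i. i \<in> A)) s = (\<Sum>B\<in>{A, insert K A}. ?g B s)" for s
      unfolding pair using A by (cases "s K") (auto simp: initial_path_eq_iff All_less_Suc)
    then have "evol n t (?f K (initial_path K (\<lambda>i. i \<in> A))) s = (\<Sum>B\<in>{A, insert K A}. evol n t (?g B) s)" for n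
      using evol_sum[of "{A, insert K A}" ?g 1 n t s] by simp
    then have "evol n t (?f K (initial_path K (\<lambda>i. i \<in> A))) s = evol n t (?g A) s + evol n t (?g (insert K A)) s" for n
      by (simp only: pair)
    then show "(\<lambda>n. evol n t (?f K (initial_path K (\<lambda>i. i \<in> A))) s) \<longlonglongrightarrow> Q (Suc K) A + Q (Suc K) (insert K A)"
      by (simp only:) (intro tendsto_add Q)
  qed
  obtain M where M: "prob_space M" "sets M = sets trajectory_space"
    and cyl: "\<And>K A. A \<subseteq> {..<K} \<Longrightarrow> measure M (cylinder K (initial_path K (\<lambda>i. i \<in> A))) = Q K A"
    using ex_trajectory_measure[of Q, OF nonneg init consistent] by blast
  show ?thesis
  proof (rule ex1I)
    have "(\<lambda>L. \<Sum>v \<in> {v \<in> triangle_paths L. restrict v {..K} = w}.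
         triangle_transition L t (restrict x {..L}) v)
      \<longlonglongrightarrow> measure M (cylinder K w)" if w: "w \<in> triangle_paths K" for K w
    proof -
      obtain A where A: "A \<subseteq> {..<K}" "w = initial_path K (\<lambda>i. i \<in> A)"
        using w by (auto simp: triangle_paths_eq)
      have path: "restrict x {..L} = initial_path L s" for L
        by (simp add: initial_path_def s_def walk_steps[OF x])
      \<comment> \<open>The triangle of size \<open>n + 1\<close> carries \<open>gen n\<close>; the
        index shift turns \<open>L - 1\<close> into \<open>n\<close>.\<close>
      have "(\<lambda>L. evol (L - 1) t (?f K w) s) \<longlonglongrightarrow> Q K A"
        by (rule LIMSEQ_imp_Suc) (use Q[of K A] A in simp)
      moreover have "\<forall>\<^sub>F L in sequentially. evol (L - 1) t (?f K w) s
          = (\<Sum>v \<in> {v \<in> triangle_paths L. restrict v {..K} = w}. triangle_transition L t (restrict x {..L}) v)"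
        using eventually_ge_at_top[of K]
        by eventually_elim (simp only: path triangle_transition_marginal)
      ultimately have "(\<lambda>L. \<Sum>v \<in> {v \<in> triangle_paths L. restrict v {..K} = w}.
         triangle_transition L t (restrict x {..L}) v) \<longlonglongrightarrow> Q K A"
        by (rule Lim_transform_eventually)
      then show ?thesis using cyl A by simp
    qed
    with M show PM: "?P M" unfolding cylinder_def by blast
    fix N assume N: "?P N"
    show "N = M"
    proof (rule measure_eq_cylinders)
      fix K w assume "w \<in> triangle_paths K"
      then show "measure N (cylinder K w) = measure M (cylinder K w)"
        unfolding cylinder_def using PM N by (meson LIMSEQ_unique)
    qed (use M N in auto)
  qed
qed

lemma dynamics_spec:
  assumes t: "0 \<le> t" and x: "x \<in> trajectories"
  shows "prob_space (dynamics t x)" "sets (dynamics t x) = sets trajectory_space"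
    and "w \<in> triangle_paths K \<Longrightarrow>
      (\<lambda>n. evol n t (\<lambda>s. of_bool (initial_path K s = w)) (steps x)) \<longlonglongrightarrow> measure (dynamics t x) (cylinder K w)"
proof -
  note D = theI'[OF dynamics_exists_unique[OF t x], folded dynamics_def]
  show "prob_space (dynamics t x)" "sets (dynamics t x) = sets trajectory_space"
    using D by auto
  assume w: "w \<in> triangle_paths K"
  have path: "restrict x {..L} = initial_path L (steps x)" for L
    by (simp add: initial_path_def walk_steps[OF x])
  have "(\<lambda>L. \<Sum>v \<in> {v \<in> triangle_paths L. restrict v {..K} = w}. triangle_transition L t (restrict x {..L}) v)
      \<longlonglongrightarrow> measure (dynamics t x) (cylinder K w)"
    using D w unfolding cylinder_def by blast
  moreover have "\<forall>\<^sub>F L in sequentially.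
      (\<Sum>v \<in> {v \<in> triangle_paths L. restrict v {..K} = w}. triangle_transition L t (restrict x {..L}) v)
      = evol (L - 1) t (\<lambda>s. of_bool (initial_path K s = w)) (steps x)"
    using eventually_ge_at_top[of K]
    by eventually_elim (simp only: path triangle_transition_marginal)
  ultimately have "(\<lambda>L. evol (L - 1) t (\<lambda>s. of_bool (initial_path K s = w)) (steps x))
      \<longlonglongrightarrow> measure (dynamics t x) (cylinder K w)"
    by (rule Lim_transform_eventually)
  from LIMSEQ_Suc[OF this]
  show "(\<lambda>n. evol n t (\<lambda>s. of_bool (initial_path K s = w)) (steps x)) \<longlonglongrightarrow> measure (dynamics t x) (cylinder K w)"
    by simp
qed

text \<open>With the shift by \<open>K\<close>, every term depends only on the first
  \<open>n + K + 1\<close> steps, so it is measurable with a finite-sum expectation for each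
  \<open>n\<close>, not just eventually.\<close>

lemma dynamics_spec_shifted:
  assumes t: "0 \<le> t" and x: "x \<in> trajectories" and w: "w \<in> triangle_paths K"
  shows "(\<lambda>n. evol (n + K) t (\<lambda>s. of_bool (initial_path K s = w)) (steps x))
    \<longlonglongrightarrow> measure (dynamics t x) (cylinder K w)"
  using dynamics_spec(3)[OF t x w] by (rule LIMSEQ_ignore_initial_segment)

lemma evol_steps_measurable:
  "(\<lambda>x. evol (n + K) t (\<lambda>s. of_bool (initial_path K s = w)) (steps x)) \<in> borel_measurable trajectory_space"
  by (intro steps_measurable[of "Suc (n + K)"] evol_depends_on depends_on_mono[OF depends_on_initial_path]) simp

text \<open>The kernel property that the monadic bind requires: on a cylinder the law is a pointwise
  limit of functions of finitely many steps, and cylinders generate.\<close>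

lemma dynamics_measurable:
  assumes t: "0 \<le> t"
  shows "dynamics t \<in> trajectory_space \<rightarrow>\<^sub>M prob_algebra trajectory_space"
proof (rule measurable_prob_algebra_generated[OF sets_trajectory_space Int_stable_cylinders cylinders_subset])
  show "prob_space (dynamics t x)" "sets (dynamics t x) = sets trajectory_space"
    if "x \<in> space trajectory_space" for x
    using that dynamics_spec[OF t] by auto
  fix A assume "A \<in> cylinders"
  then consider "A = {}" | K w where "A = cylinder K w" "w \<in> triangle_paths K"
    by (auto simp: cylinders_def)
  then show "(\<lambda>x. emeasure (dynamics t x) A) \<in> borel_measurable trajectory_space"
  proof cases
    case 2
    have "(\<lambda>x. measure (dynamics t x) A) \<in> borel_measurable trajectory_space"
      using dynamics_spec_shifted[OF t _ 2(2)] 2(1)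
      by (intro borel_measurable_LIMSEQ_real[OF _ evol_steps_measurable[of _ K t w]]) auto
    then have "(\<lambda>x. ennreal (measure (dynamics t x) A)) \<in> borel_measurable trajectory_space"
      by measurable
    then show ?thesis
      by (rule measurable_cong[THEN iffD1, rotated])
        (simp add: finite_measure.emeasure_eq_measure prob_space.finite_measure dynamics_spec[OF t])
  qed simp
qed

section \<open>The logistic flow and the limit of growing triangles\<close>

text \<open>The odds \<open>b t / (1 - b t)\<close> are \<open>exp (- t)\<close> times the initial
  odds, which is the solution of the logistic equation.\<close>

lemma logistic_flow:
  fixes \<beta> :: real
  assumes \<beta>: "0 < \<beta>" "\<beta> < 1"
    and b: "\<And>t. b t = \<beta> * exp (- t) / (1 - \<beta> + \<beta> * exp (- t))"
  shows "(b has_real_derivative - (b t * (1 - b t))) (at t)" and "0 \<le> b t" "b t \<le> 1" "b 0 = \<beta>"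
proof -
  have pos: "0 < 1 - \<beta> + \<beta> * exp (- t)" for t
    using \<beta> by (intro add_pos_pos mult_pos_pos) auto
  show "0 \<le> b t" "b t \<le> 1" "b 0 = \<beta>"
    using \<beta> pos[of t] by (auto simp: b divide_simps)
  have "1 - b t = (1 - \<beta>) / (1 - \<beta> + \<beta> * exp (- t))"
    using pos[of t] by (simp add: b divide_simps)
  then have eq: "- (b t * (1 - b t)) = - (\<beta> * exp (- t)) * (1 - \<beta>) / (1 - \<beta> + \<beta> * exp (- t)) ^ 2"
    by (simp add: b power2_eq_square)
  have "((\<lambda>t. \<beta> * exp (- t) / (1 - \<beta> + \<beta> * exp (- t))) has_real_derivative
      - (\<beta> * exp (- t)) * (1 - \<beta>) / (1 - \<beta> + \<beta> * exp (- t)) ^ 2) (at t)"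
    using pos[of t]
    by (auto intro!: derivative_eq_intros simp: power2_eq_square divide_simps) (simp add: algebra_simps)
  then show "(b has_real_derivative - (b t * (1 - b t))) (at t)"
    unfolding eq by (simp add: b[abs_def])
qed

theorem proposition2:
  fixes \<beta> \<tau> :: real
  assumes "0 < \<beta>" and "\<beta> < 1" and "0 \<le> \<tau>"
  shows "bernoulli_trajectory \<beta> \<bind> dynamics \<tau> =
    bernoulli_trajectory (\<beta> * exp (- \<tau>) / (1 - \<beta> + \<beta> * exp (- \<tau>)))"
proof -
  define b where "b = (\<lambda>t. \<beta> * exp (- t) / (1 - \<beta> + \<beta> * exp (- t)))"
  have b_eq: "b t = \<beta> * exp (- t) / (1 - \<beta> + \<beta> * exp (- t))" for t by (simp add: b_def)
  note b = logistic_flow[OF assms(1,2) b_eq]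
  let ?B = "bernoulli_trajectory \<beta>"
  interpret B: prob_space ?B by (rule prob_space_bernoulli_trajectory)
  have D: "dynamics \<tau> \<in> ?B \<rightarrow>\<^sub>M prob_algebra trajectory_space"
    using dynamics_measurable[OF assms(3)] by (simp cong: measurable_cong_sets)
  then have D': "dynamics \<tau> \<in> ?B \<rightarrow>\<^sub>M subprob_algebra trajectory_space"
    by (rule measurable_prob_algebraD)
  have "?B \<bind> dynamics \<tau> = bernoulli_trajectory (b \<tau>)"
  proof (rule measure_eq_cylinders)
    show "prob_space (?B \<bind> dynamics \<tau>)"
      by (rule B.prob_space_bind[OF _ D']) (auto intro!: AE_I2 dynamics_spec assms)
    show "sets (?B \<bind> dynamics \<tau>) = sets trajectory_space"
      by (rule sets_bind) (auto simp: dynamics_spec assms B.not_empty[simplified])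
    fix K w assume w: "w \<in> triangle_paths K"
    let ?f = "\<lambda>s. of_bool (initial_path K s = w) :: real"
    let ?C = "2 * 1 * 2 ^ K :: real"
    obtain A where A: "A \<subseteq> {..<K}" "w = initial_path K (\<lambda>i. i \<in> A)"
      using w by (auto simp: triangle_paths_eq)
    have f: "depends_on K ?f" by (rule depends_on_initial_path)
    have dep: "depends_on (Suc (n + K)) ?f" for n using f by (rule depends_on_mono) simp
    have osc: "osc_bound ?C (1/2) ?f"
      by (rule osc_bound_depends_on[OF f]) simp
    \<comment> \<open>The indicator sees only \<open>K\<close> bits, so this side is constant in
      \<open>n\<close> and is the value that the evolved expectations approach.\<close>
    have exp_const: "expect (b \<tau>) (Suc (n + K)) ?f = measure (bernoulli_trajectory (b \<tau>)) (cylinder K w)" for n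
    proof -
      have "expect (b \<tau>) (Suc (n + K)) ?f = expect (b \<tau>) K ?f"
        by (rule expect_depends_on[OF f]) simp
      also have "\<dots> = (\<Sum>A'\<in>Pow {..<K}. if A' = A then weight (b \<tau>) K A else 0)"
        unfolding expect_def using A
        by (intro sum.cong) (auto simp: initial_path_eq_iff)
      also have "\<dots> = weight (b \<tau>) K A" using A by (subst sum.delta) auto
      finally show ?thesis
        using bernoulli_trajectory_cylinder[OF b(2,3) A(1), of \<tau>] A(2) by simp
    qed
    \<comment> \<open>Dominated convergence carries the limit defining the dynamics from single
      starting trajectories to the Bernoulli average.\<close>
    have "(\<lambda>n. \<integral>x. evol (n + K) \<tau> ?f (steps x) \<partial>?B) \<longlonglongrightarrow> (\<integral>x. measure (dynamics \<tau> x) (cylinder K w) \<partial>?B)"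
    proof (rule integral_dominated_convergence[where w="\<lambda>_. 1"])
      show meas: "(\<lambda>x. evol (n + K) \<tau> ?f (steps x)) \<in> borel_measurable ?B" for n
        using evol_steps_measurable by (simp cong: measurable_cong_sets)
      show lim: "AE x in ?B. (\<lambda>n. evol (n + K) \<tau> ?f (steps x)) \<longlonglongrightarrow> measure (dynamics \<tau> x) (cylinder K w)"
        by (rule AE_I2) (use dynamics_spec_shifted[OF assms(3) _ w] in simp)
      show "(\<lambda>x. measure (dynamics \<tau> x) (cylinder K w)) \<in> borel_measurable ?B"
        by (rule borel_measurable_LIMSEQ_real[OF _ meas]) (use dynamics_spec_shifted[OF assms(3) _ w] in simp)
      have "\<bar>evol (n + K) \<tau> ?f s\<bar> \<le> 1" for n s
        using evol_range[OF assms(3), of ?f 0 1 "n + K" s] by auto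
      then show "AE x in ?B. norm (evol (n + K) \<tau> ?f (steps x)) \<le> 1" for n
        by (auto intro!: AE_I2)
    qed simp
    also have "(\<lambda>n. \<integral>x. evol (n + K) \<tau> ?f (steps x) \<partial>?B) = (\<lambda>n. expect \<beta> (Suc (n + K)) (evol (n + K) \<tau> ?f))"
      using assms by (auto intro!: bernoulli_trajectory_integral evol_depends_on dep)
    also have "(\<integral>x. measure (dynamics \<tau> x) (cylinder K w) \<partial>?B) = measure (?B \<bind> dynamics \<tau>) (cylinder K w)"
      using B.measure_bind[OF D' cylinder_sets[OF w]] by simp
    finally have lim1: "(\<lambda>n. expect \<beta> (Suc (n + K)) (evol (n + K) \<tau> ?f))
        \<longlonglongrightarrow> measure (?B \<bind> dynamics \<tau>) (cylinder K w)" .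
    have "(\<lambda>n. real (Suc (n + K)) * spread \<tau> ^ (n + K)) \<longlonglongrightarrow> 0"
      using spread_bounds[of \<tau>] assms(3)
      by (intro LIMSEQ_ignore_initial_segment[OF summable_LIMSEQ_zero[OF summable_linear_geometric]]) auto
    then have bound0: "(\<lambda>n. \<tau> * ?C * (real (Suc (n + K)) * spread \<tau> ^ (n + K))) \<longlonglongrightarrow> 0"
      by (rule tendsto_mult_right_zero)
    have "\<bar>measure (bernoulli_trajectory (b \<tau>)) (cylinder K w) - expect \<beta> (Suc (n + K)) (evol (n + K) \<tau> ?f)\<bar>
        \<le> \<tau> * ?C * (real (Suc (n + K)) * spread \<tau> ^ (n + K))" for n
      using expect_evol_diff[OF osc, of 1 \<tau> b "n + K"] b assms(3) by (simp add: exp_const)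
    then have bound: "\<forall>n. norm (measure (bernoulli_trajectory (b \<tau>)) (cylinder K w) - expect \<beta> (Suc (n + K)) (evol (n + K) \<tau> ?f))
        \<le> \<tau> * ?C * (real (Suc (n + K)) * spread \<tau> ^ (n + K))"
      unfolding real_norm_def by blast
    have "(\<lambda>n. measure (bernoulli_trajectory (b \<tau>)) (cylinder K w)
        - expect \<beta> (Suc (n + K)) (evol (n + K) \<tau> ?f)) \<longlonglongrightarrow> 0"
      by (rule Lim_null_comparison[OF always_eventually[OF bound] bound0])
    from tendsto_diff[OF tendsto_const this, of "measure (bernoulli_trajectory (b \<tau>)) (cylinder K w)"]
    have "(\<lambda>n. expect \<beta> (Suc (n + K)) (evol (n + K) \<tau> ?f)) \<longlonglongrightarrow> measure (bernoulli_trajectory (b \<tau>)) (cylinder K w)"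
      by simp
    with lim1 show "measure (?B \<bind> dynamics \<tau>) (cylinder K w) = measure (bernoulli_trajectory (b \<tau>)) (cylinder K w)"
      by (rule LIMSEQ_unique)
  qed (auto intro: prob_space_bernoulli_trajectory)
  then show ?thesis by (simp add: b_def)
qed

end
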